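(* Let $\mathcal{L}$ and $\mathcal{ID}^{\sqcup\!\times}_*$ and $W$ be as in the context. Then $W$ maps $\mathcal{L}$ onto $\mathcal{ID}^{\sqcup\!\times}_*$, and for every $\mu \in \mathcal{L}$, \[ \exp\big(i F_\mu(z)\big) = \eta_{W(\mu)}(e^{iz}) \qquad \text{for all } z \in \mathbb{C}^+ . \] Moreover, for $\mu, \mu' \in \mathcal{L}$ we have $W(\mu) = W(\mu')$ if and only if $\mu'$ is the translate of $\mu$ by $2\pi n$ for some $n \in \mathbb{Z}$; that is, the pre-image in $\mathcal{L}$ of each $\nu \in \mathcal{ID}^{\sqcup\!\times}_*$ is exactly one equivalence class modulo translations by $2\pi\mathbb{Z}$.
   Context: For a Borel probability measure $\mu$ on $\mathbb{R}$, let $G_\mu(z)=\int_{\mathbb{R}} \frac{1}{z-x}\,d\mu(x)$ and $F_\mu(z) = 1/G_\mu(z)$ for $z$ in the upper half-plane $\mathbb{C}^+$. Let $\mathcal{L}$ be the set of probability measures $\mu$ on $\mathbb{R}$ such that $F_\mu(z+2\pi)=F_\mu(z)+2\pi$ for all $z\in\mathbb{C}^+$. For a probability measure $\nu$ on the unit circle $\mathbb{T}$, let $\psi_\nu(z)=\int_{\mathbb{T}}\frac{z\zeta}{1-z\zeta}\,d\nu(\zeta)$ and $\eta_\nu(z)=\frac{\psi_\nu(z)}{1+\psi_\nu(z)}$ for $z$ in the open unit disc $\mathbb{D}$. Let $\mathcal{ID}^{\sqcup\!\times}_*$ be the set of probability measures $\nu$ on $\mathbb{T}$ such that $\eta_\nu'(0)\neq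 0$ and $\eta_\nu(z)=0$ only for $z=0$ (these are exactly the measures infinitely divisible with respect to multiplicative Boolean convolution, other than the Haar measure). The wrapping map $W$ sends a probability measure $\mu$ on $\mathbb{R}$ to the probability measure on $\mathbb{T}$ given by $\int_{\mathbb{T}} f\,dW(\mu)=\int_{\mathbb{R}} f(e^{-ix})\,d\mu(x)$ (push-forward under $x\mapsto e^{-ix}$). *)

theory Defs
  imports "HOL-Probability.Probability"
begin

definition cauchy_G :: "real measure \<Rightarrow> complex \<Rightarrow> complex" where
  "cauchy_G \<mu> z = (\<integral>x. 1 / (z - complex_of_real x) \<partial>\<mu>)"

definition cauchy_F :: "real measure \<Rightarrow> complex \<Rightarrow> complex" where
  "cauchy_F \<mu> z = 1 / cauchy_G \<mu> z"

definition real_prob :: "real measure \<Rightarrow> bool" where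
  "real_prob \<mu> \<longleftrightarrow> prob_space \<mu> \<and> sets \<mu> = sets (borel :: real measure)"

definition class_L :: "real measure set" where
  "class_L = {\<mu>. real_prob \<mu> \<and>
     (\<forall>z. Im z > 0 \<longrightarrow> cauchy_F \<mu> (z + 2 * complex_of_real pi) = cauchy_F \<mu> z + 2 * complex_of_real pi)}"

definition circle_prob :: "complex measure \<Rightarrow> bool" where
  "circle_prob \<nu> \<longleftrightarrow> prob_space \<nu> \<and> sets \<nu> = sets (borel :: complex measure)
      \<and> emeasure \<nu> (sphere 0 1) = 1"

definition psi_T :: "complex measure \<Rightarrow> complex \<Rightarrow> complex" where
  "psi_T \<nu> z = (\<integral>\<zeta>. z * \<zeta> / (1 - z * \<zeta>) \<partial>\<nu>)"

definition eta_T :: "complex measure \<Rightarrow> complex \<Rightarrow> complex" where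
  "eta_T \<nu> z = psi_T \<nu> z / (1 + psi_T \<nu> z)"

text \<open>ID_* for multiplicative Boolean convolution (Haar measure excluded).\<close>
definition class_ID_star :: "complex measure set" where
  "class_ID_star = {\<nu>. circle_prob \<nu> \<and> deriv (eta_T \<nu>) 0 \<noteq> 0 \<and>
     (\<forall>z \<in> ball 0 1. eta_T \<nu> z = 0 \<longrightarrow> z = 0)}"

definition wrap :: "real measure \<Rightarrow> complex measure" where
  "wrap \<mu> = distr \<mu> borel (\<lambda>x. cis (- x))"

definition translate :: "real measure \<Rightarrow> real \<Rightarrow> real measure" where
  "translate \<mu> a = distr \<mu> borel (\<lambda>x. x + a)"

end

theory Submission
  imports Defs "HOL-Complex_Analysis.Complex_Analysis"
begin

text \<open>
  For \<open>\<mu>\<close> in the class \<open>L\<close> the wrapping formula is the partial fraction expansion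
  \<open>cot (u / 2) = \<Sum>k. 2 / (u + 2 \<pi> k)\<close> used twice: integrating it against \<open>\<mu>\<close> turns the poles into the values
  \<open>G (z + 2 \<pi> k) = 1 / (F z + 2 \<pi> k)\<close>, and summing these gives \<open>cot (F z / 2)\<close>. A vanishing derivative
  of \<open>\<eta>\<close> at \<open>0\<close> would force \<open>Im (F (i y)) \<ge> 2 y - c\<close>, whereas \<open>F (i y) / (i y) \<rightarrow> 1\<close>.

  Conversely, if \<open>\<eta> q / q\<close> has no zero in the disc, it has a holomorphic logarithm \<open>g\<close>, and
  \<open>F z = z - i g (exp (i z))\<close> satisfies \<open>exp (i F z) = \<eta> (exp (i z))\<close>. The Schwarz lemma gives
  \<open>Im (F z) \<ge> Im z\<close>, so \<open>1 / F\<close> is a Cauchy transform: for \<open>F (z + i \<epsilon>)\<close> the measure is written down from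
  boundary values with the mean value property on the disc, and Helly's theorem removes \<open>\<epsilon>\<close>.

  Two measures with the same wrapping have \<open>F\<close> differing by a continuous function with values in
  \<open>2 \<pi> \<int>\<close>, that is by a constant, which is a translation. Both on the circle and, by means of the
  Cayley transform, on the line, measures are determined by their transforms because trigonometric
  polynomials are dense.
\<close>

section \<open>Measures on the circle\<close>

text \<open>All transforms are linked by w -> (1 + w) / (1 - w): it sends \<eta> to 1 + 2 \<psi>,
  and it sends exp (i u) to i cot (u / 2). The wrapping formula thus says that averaging i cot ((z -
  x) / 2) over \<mu> gives i cot (F z / 2), and the cotangent series applies because 1 / (z - x)
  averages to 1 / F z. The substitution q = exp (i z) never reaches q = 0. Hence the condition on
  the derivative of \<eta> at 0 cannot be read off from the formula and needs the growth of F along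
  the imaginary axis, and the uniqueness lemmas assume equality only for q \<noteq> 0. For
  surjectivity, F z - z depends only on exp (i z). This makes the periodicity automatic and bounds F
  z - z on each half-plane Im z \<ge> \<epsilon>, which takes the place of the normalisation F (i y)
  / (i y) -> 1 and also yields tightness. The shift by \<epsilon> serves two ends: F becomes
  holomorphic across the real line, and it stays away from 0 on the closed half-plane.\<close>

lemma circle_prob_imp_prob_space: "circle_prob \<nu> \<Longrightarrow> prob_space \<nu>"
  and circle_prob_sets: "circle_prob \<nu> \<Longrightarrow> sets \<nu> = sets borel"
  by (auto simp: circle_prob_def)

lemma circle_prob_AE_norm:
  assumes "circle_prob \<nu>"
  shows "AE \<zeta> in \<nu>. norm \<zeta> = 1"
proof -
  interpret prob_space \<nu> using assms by (rule circle_prob_imp_prob_space)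
  have "prob (sphere 0 1) = 1" using assms by (simp add: circle_prob_def measure_def)
  then have "AE \<zeta> in \<nu>. \<zeta> \<in> sphere 0 1" by (rule AE_prob_1)
  then show ?thesis by simp
qed

lemma circle_prob_integrable:
  fixes f :: "complex \<Rightarrow> 'a :: {banach, second_countable_topology}"
  assumes \<nu>: "circle_prob \<nu>" and f: "f \<in> borel_measurable borel"
    and B: "\<And>\<zeta>. norm \<zeta> = 1 \<Longrightarrow> norm (f \<zeta>) \<le> B"
  shows "integrable \<nu> f"
proof -
  interpret prob_space \<nu> using \<nu> by (rule circle_prob_imp_prob_space)
  have [measurable]: "f \<in> borel_measurable \<nu>"
    using f by (simp add: measurable_cong_sets[OF circle_prob_sets[OF \<nu>] refl])
  show ?thesis
    by (rule integrable_const_bound[where B = B]) (use circle_prob_AE_norm[OF \<nu>] B in auto)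
qed

lemma circle_prob_distr:
  assumes "real_prob \<mu>" "f \<in> borel_measurable borel" "\<And>x. norm (f x) = 1"
  shows "circle_prob (distr \<mu> borel f)"
proof -
  interpret prob_space \<mu> using assms(1) by (simp add: real_prob_def)
  have sets: "sets \<mu> = sets borel" using assms(1) by (simp add: real_prob_def)
  have f [measurable]: "f \<in> borel_measurable \<mu>"
    using assms(2) by (simp add: measurable_cong_sets[OF sets refl])
  have "f -` sphere 0 1 \<inter> space \<mu> = space \<mu>" using assms(3) by auto
  then have "emeasure (distr \<mu> borel f) (sphere 0 1) = 1"
    by (simp add: emeasure_distr emeasure_space_1)
  then show ?thesis
    by (simp add: circle_prob_def prob_space_distr)
qed

lemma circle_prob_integral_cong:
  fixes f g :: "complex \<Rightarrow> 'a :: {banach, second_countable_topology}"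
  assumes \<nu>: "circle_prob \<nu>"
    and meas: "f \<in> borel_measurable borel" "g \<in> borel_measurable borel"
    and eq: "\<And>\<zeta>. norm \<zeta> = 1 \<Longrightarrow> f \<zeta> = g \<zeta>"
  shows "(\<integral>\<zeta>. f \<zeta> \<partial>\<nu>) = (\<integral>\<zeta>. g \<zeta> \<partial>\<nu>)"
proof (rule integral_cong_AE)
  show "f \<in> borel_measurable \<nu>" "g \<in> borel_measurable \<nu>"
    using meas by (simp_all add: measurable_cong_sets[OF circle_prob_sets[OF \<nu>] refl])
  show "AE \<zeta> in \<nu>. f \<zeta> = g \<zeta>"
    using circle_prob_AE_norm[OF \<nu>] by eventually_elim (rule eq)
qed

text \<open>This is \<psi> q / q with the singularity at q = 0 removed. It carries the information
  at 0 that \<psi> and \<eta> lose through their factor q.\<close>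

definition chi_T :: "complex measure \<Rightarrow> complex \<Rightarrow> complex" where
  "chi_T \<nu> q = (\<integral>\<zeta>. \<zeta> / (1 - q * \<zeta>) \<partial>\<nu>)"

lemma psi_T_eq_chi_T: "psi_T \<nu> q = q * chi_T \<nu> q"
proof -
  have "(\<lambda>\<zeta>. q * \<zeta> / (1 - q * \<zeta>)) = (\<lambda>\<zeta>. q * (\<zeta> / (1 - q * \<zeta>)))" by simp
  then show ?thesis unfolding psi_T_def chi_T_def by (simp only: integral_mult_right_zero)
qed

lemma norm_one_minus_mult_ge:
  fixes q \<zeta> :: complex
  assumes "norm \<zeta> = 1"
  shows "1 - norm q \<le> norm (1 - q * \<zeta>)" 
  using norm_triangle_ineq2[of "1 :: complex" "q * \<zeta>"] assms by (simp add: norm_mult)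

text \<open>Integrating the geometric series termwise shows the moments of order at least 1 as
  Taylor coefficients. This gives holomorphy, and it later lets the moments be recovered from the
  transform.\<close>

lemma chi_T_sums:
  assumes \<nu>: "circle_prob \<nu>" and q: "norm q < 1"
  shows "(\<lambda>n. (\<integral>\<zeta>. \<zeta> ^ Suc n \<partial>\<nu>) * q ^ n) sums chi_T \<nu> q"
proof -
  interpret prob_space \<nu> using \<nu> by (rule circle_prob_imp_prob_space)
  note AE = circle_prob_AE_norm[OF \<nu>]
  let ?f = "\<lambda>n \<zeta>. \<zeta> ^ Suc n * q ^ n"
  have int: "integrable \<nu> (?f n)" for n
    by (rule circle_prob_integrable[OF \<nu>, where B = 1])
       (use q in \<open>auto simp: norm_mult norm_power power_le_one\<close>)
  have norm_eq: "(\<integral>\<zeta>. norm (?f n \<zeta>) \<partial>\<nu>) = norm q ^ n" for n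
  proof -
    have "(\<integral>\<zeta>. norm (?f n \<zeta>) \<partial>\<nu>) = (\<integral>\<zeta>. norm q ^ n \<partial>\<nu>)"
      by (rule circle_prob_integral_cong[OF \<nu>]) (auto simp: norm_mult norm_power)
    then show ?thesis by (simp add: prob_space)
  qed
  have "(\<lambda>n. \<integral>\<zeta>. ?f n \<zeta> \<partial>\<nu>) sums (\<integral>\<zeta>. (\<Sum>n. ?f n \<zeta>) \<partial>\<nu>)"
  proof (rule sums_integral[OF int])
    show "AE \<zeta> in \<nu>. summable (\<lambda>n. norm (?f n \<zeta>))"
      using AE by eventually_elim (use q in \<open>simp add: norm_mult norm_power summable_geometric\<close>)
    show "summable (\<lambda>n. \<integral>\<zeta>. norm (?f n \<zeta>) \<partial>\<nu>)"
      unfolding norm_eq using q by (simp add: summable_geometric)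
  qed
  also have "(\<integral>\<zeta>. (\<Sum>n. ?f n \<zeta>) \<partial>\<nu>) = chi_T \<nu> q"
    unfolding chi_T_def
  proof (rule circle_prob_integral_cong[OF \<nu>])
    fix \<zeta> :: complex assume "norm \<zeta> = 1"
    then have "norm (q * \<zeta>) < 1" using q by (simp add: norm_mult)
    then have "(\<lambda>n. \<zeta> * (q * \<zeta>) ^ n) sums (\<zeta> * (1 / (1 - q * \<zeta>)))"
      by (intro sums_mult geometric_sums)
    then show "(\<Sum>n. ?f n \<zeta>) = \<zeta> / (1 - q * \<zeta>)"
      by (simp add: sums_iff power_mult_distrib mult_ac)
  qed measurable
  finally show ?thesis by simp
qed

lemma chi_T_holomorphic:
  assumes "circle_prob \<nu>"
  shows "chi_T \<nu> holomorphic_on ball 0 1"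
  by (rule power_series_holomorphic[where a = "\<lambda>n. \<integral>\<zeta>. \<zeta> ^ Suc n \<partial>\<nu>"])
     (use chi_T_sums[OF assms] in simp)

text \<open>The integrand of 1 + 2 \<psi> is (1 + q \<zeta>) / (1 - q \<zeta>), whose real part is
  the Poisson kernel. Positivity is used twice: it excludes zeros of 1 + \<psi>, and it is
  equivalent to |\<psi>| < |1 + \<psi>|, that is, to |\<eta>| < 1.\<close>

lemma Re_one_plus_two_psi_T_pos:
  assumes \<nu>: "circle_prob \<nu>" and q: "norm q < 1"
  shows "Re (1 + 2 * psi_T \<nu> q) > 0"
proof -
  interpret prob_space \<nu> using \<nu> by (rule circle_prob_imp_prob_space)
  let ?h = "\<lambda>\<zeta>. q * \<zeta> / (1 - q * \<zeta>)"
  \<comment> \<open>A lower bound of the Poisson kernel, from |1 - q \<zeta>| \<le> 2. A positive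
    constant keeps the inequality strict after integration.\<close>
  let ?c = "(1 - (norm q)\<^sup>2) / 4"
  have bnd: "norm (?h \<zeta>) \<le> norm q / (1 - norm q)" if "norm \<zeta> = 1" for \<zeta>
    using norm_one_minus_mult_ge[OF that, of q] q that
    by (auto simp: norm_divide norm_mult intro!: divide_left_mono mult_pos_pos)
  have int: "integrable \<nu> ?h"
    by (rule circle_prob_integrable[OF \<nu> _ bnd]) auto
  have pos: "?c \<le> Re (1 + 2 * ?h \<zeta>)" if "norm \<zeta> = 1" for \<zeta>
  proof -
    have n: "norm (q * \<zeta>) = norm q" using that by (simp add: norm_mult)
    have ne: "1 - q * \<zeta> \<noteq> 0" using norm_one_minus_mult_ge[OF that, of q] q by auto
    have "1 + 2 * ?h \<zeta> = (1 + q * \<zeta>) / (1 - q * \<zeta>)" using ne by (simp add: field_simps)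
    also have "Re \<dots> = (1 - (norm (q * \<zeta>))\<^sup>2) / (norm (1 - q * \<zeta>))\<^sup>2"
      unfolding Re_divide cmod_power2 by (simp add: algebra_simps power2_eq_square)
    also have "\<dots> \<ge> ?c"
    proof (unfold n, rule divide_left_mono)
      have "norm (1 - q * \<zeta>) \<le> 2" using norm_triangle_ineq4[of 1 "q * \<zeta>"] n q by simp
      from power_mono[OF this, of 2] show "(norm (1 - q * \<zeta>))\<^sup>2 \<le> 4" by simp
      show "0 \<le> 1 - (norm q)\<^sup>2" using q by (simp add: power_le_one)
    qed (use ne in auto)
    finally show ?thesis .
  qed
  have "0 < ?c" using q by (simp add: power_less_one_iff)
  also have "?c = (\<integral>\<zeta>. ?c \<partial>\<nu>)" by (simp add: prob_space)
  also have "\<dots> \<le> (\<integral>\<zeta>. Re (1 + 2 * ?h \<zeta>) \<partial>\<nu>)"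
  proof (rule integral_mono_AE)
    show "AE \<zeta> in \<nu>. ?c \<le> Re (1 + 2 * ?h \<zeta>)"
      using circle_prob_AE_norm[OF \<nu>] by eventually_elim (rule pos)
    show "integrable \<nu> (\<lambda>\<zeta>. Re (1 + 2 * ?h \<zeta>))"
      by (intro integrable_Re Bochner_Integration.integrable_add integrable_mult_right int) simp
  qed simp
  also have "\<dots> = Re (\<integral>\<zeta>. 1 + 2 * ?h \<zeta> \<partial>\<nu>)"
    by (intro integral_Re Bochner_Integration.integrable_add integrable_mult_right int) simp
  also have "(\<integral>\<zeta>. 1 + 2 * ?h \<zeta> \<partial>\<nu>) = 1 + 2 * psi_T \<nu> q"
    unfolding psi_T_def
    by (subst Bochner_Integration.integral_add)
       (auto simp only: int integrable_mult_right integral_mult_right_zero lebesgue_integral_const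
          integrable_const prob_space scaleR_one)
  finally show ?thesis .
qed

lemma one_plus_psi_T_nonzero:
  assumes "circle_prob \<nu>" "norm q < 1"
  shows "1 + psi_T \<nu> q \<noteq> 0"
  using Re_one_plus_two_psi_T_pos[OF assms] by (auto simp: complex_eq_iff)

section \<open>Circle measures are determined by their moments\<close>

text \<open>On the circle the conjugate of \<zeta> is 1 / \<zeta>, so a real polynomial in the
  coordinates is a Laurent polynomial in \<zeta>. Its integral involves moments of both signs, and
  those of negative order are conjugates of those of positive order.\<close>

lemma circle_prob_integral_real_polynomial_eq:
  assumes \<nu>: "circle_prob \<nu>" and \<nu>': "circle_prob \<nu>'"
    and moments: "\<And>n. (\<integral>\<zeta>. \<zeta> ^ n \<partial>\<nu>) = (\<integral>\<zeta>. \<zeta> ^ n \<partial>\<nu>')"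
    and f: "real_polynomial_function (f :: complex \<Rightarrow> real)"
  shows "(\<integral>\<zeta>. f \<zeta> \<partial>\<nu>) = (\<integral>\<zeta>. f \<zeta> \<partial>\<nu>')"
proof -
  \<comment> \<open>The factor \<open>\<zeta> ^ N\<close> clears the negative powers, so that the
    induction can work with ordinary polynomials.\<close>
  have "\<exists>p N. \<forall>\<zeta>\<in>sphere 0 1. of_real (f \<zeta>) * \<zeta> ^ N = poly p \<zeta>"
    using f
  proof induction
    case (linear f)
    interpret bounded_linear f by fact
    \<comment> \<open>The coefficients come from Re \<zeta> = (\<zeta> + 1 / \<zeta>) / 2 and Im
      \<zeta> = (\<zeta> - 1 / \<zeta>) / (2 i), multiplied by \<zeta>.\<close>
    have "of_real (f \<zeta>) * \<zeta> ^ 1 = poly [:(f 1 + \<i> * f \<i>) / 2, 0, (f 1 - \<i> * f \<i>) / 2:] \<zeta>"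
      if "\<zeta> \<in> sphere 0 1" for \<zeta>
    proof -
      have "\<zeta> = Re \<zeta> *\<^sub>R 1 + Im \<zeta> *\<^sub>R \<i>" by (simp add: complex_eq_iff)
      then have "f \<zeta> = Re \<zeta> * f 1 + Im \<zeta> * f \<i>" by (metis add scaleR real_scaleR_def)
      moreover have "\<zeta> * cnj \<zeta> = 1" using that by (simp add: complex_norm_square[symmetric])
      then have "of_real (Re \<zeta>) * \<zeta> = (1 + \<zeta>\<^sup>2) / 2" "of_real (Im \<zeta>) * \<zeta> = \<i> * (1 - \<zeta>\<^sup>2) / 2"
        by (auto simp: complex_eq_iff power2_eq_square algebra_simps)
      moreover have "complex_of_real (Re \<zeta> * f 1 + Im \<zeta> * f \<i>) * \<zeta>
          = f 1 * (of_real (Re \<zeta>) * \<zeta>) + f \<i> * (of_real (Im \<zeta>) * \<zeta>)"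
        by (simp add: algebra_simps)
      ultimately have "of_real (f \<zeta>) * \<zeta> = f 1 * ((1 + \<zeta>\<^sup>2) / 2) + f \<i> * (\<i> * (1 - \<zeta>\<^sup>2) / 2)"
        by presburger
      then show ?thesis
        by (simp add: field_simps power2_eq_square)
    qed
    then show ?case by blast
  next
    case (const c)
    have "of_real c * \<zeta> ^ 0 = poly [:of_real c:] \<zeta>" for \<zeta> by simp
    then show ?case by blast
  next
    case (add f g)
    then obtain p N r M where
      "\<forall>\<zeta>\<in>sphere 0 1. of_real (f \<zeta>) * \<zeta> ^ N = poly p \<zeta>"
      "\<forall>\<zeta>\<in>sphere 0 1. of_real (g \<zeta>) * \<zeta> ^ M = poly r \<zeta>" by blast
    moreover have "of_real (f \<zeta> + g \<zeta>) * \<zeta> ^ (N + M)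
        = (of_real (f \<zeta>) * \<zeta> ^ N) * \<zeta> ^ M + (of_real (g \<zeta>) * \<zeta> ^ M) * \<zeta> ^ N" for \<zeta>
      by (simp add: power_add algebra_simps)
    ultimately have "\<forall>\<zeta>\<in>sphere 0 1. of_real (f \<zeta> + g \<zeta>) * \<zeta> ^ (N + M) = poly (p * monom 1 M + r * monom 1 N) \<zeta>"
      by (simp add: poly_monom)
    then show ?case by blast
  next
    case (mult f g)
    then obtain p N r M where
      "\<forall>\<zeta>\<in>sphere 0 1. of_real (f \<zeta>) * \<zeta> ^ N = poly p \<zeta>"
      "\<forall>\<zeta>\<in>sphere 0 1. of_real (g \<zeta>) * \<zeta> ^ M = poly r \<zeta>" by blast
    moreover have "of_real (f \<zeta> * g \<zeta>) * \<zeta> ^ (N + M)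
        = (of_real (f \<zeta>) * \<zeta> ^ N) * (of_real (g \<zeta>) * \<zeta> ^ M)" for \<zeta>
      by (simp add: power_add algebra_simps)
    ultimately have "\<forall>\<zeta>\<in>sphere 0 1. of_real (f \<zeta> * g \<zeta>) * \<zeta> ^ (N + M) = poly (p * r) \<zeta>"
      by (auto simp only: poly_mult)
    then show ?case by blast
  qed
  then obtain p N where p: "\<And>\<zeta>. norm \<zeta> = 1 \<Longrightarrow> of_real (f \<zeta>) * \<zeta> ^ N = poly p \<zeta>"
    by (metis mem_sphere_0)
  have f_eq: "of_real (f \<zeta>) = (\<Sum>k\<le>degree p. coeff p k * (\<zeta> ^ k * cnj \<zeta> ^ N))"
    if "norm \<zeta> = 1" for \<zeta>
  proof -
    have "\<zeta> * cnj \<zeta> = 1" using that by (simp add: complex_norm_square[symmetric])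
    then have "\<zeta> ^ N * cnj \<zeta> ^ N = 1" by (metis power_mult_distrib power_one)
    then have "of_real (f \<zeta>) = poly p \<zeta> * cnj \<zeta> ^ N"
      unfolding p[OF that, symmetric] by (simp add: mult.assoc)
    then show ?thesis by (simp add: poly_altdef sum_distrib_right mult.assoc)
  qed
  have f_cont: "continuous_on UNIV f"
    using f by (simp add: continuous_on_polymonial_function real_polynomial_function_eq)
  have expand: "of_real (\<integral>\<zeta>. f \<zeta> \<partial>\<rho>) =
      (\<Sum>k\<le>degree p. coeff p k * (if N \<le> k then \<integral>\<zeta>. \<zeta> ^ (k - N) \<partial>\<rho> else cnj (\<integral>\<zeta>. \<zeta> ^ (N - k) \<partial>\<rho>)))"
    if \<rho>: "circle_prob \<rho>" for \<rho>
  proof -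
    interpret prob_space \<rho> using \<rho> by (rule circle_prob_imp_prob_space)
    note [measurable_cong] = circle_prob_sets[OF \<rho>]
    have [measurable]: "f \<in> borel_measurable borel"
      by (rule borel_measurable_continuous_onI[OF f_cont])
    have [measurable]: "cnj \<in> borel_measurable borel"
      by (intro borel_measurable_continuous_onI continuous_intros)
    have int: "integrable \<rho> (\<lambda>\<zeta>. \<zeta> ^ k * cnj \<zeta> ^ N)" for k
      by (rule circle_prob_integrable[OF \<rho>, where B = 1]) (auto simp: norm_mult norm_power)
    have "of_real (\<integral>\<zeta>. f \<zeta> \<partial>\<rho>) = (\<integral>\<zeta>. complex_of_real (f \<zeta>) \<partial>\<rho>)" by simp
    also have "\<dots> = (\<integral>\<zeta>. (\<Sum>k\<le>degree p. coeff p k * (\<zeta> ^ k * cnj \<zeta> ^ N)) \<partial>\<rho>)"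
      by (rule circle_prob_integral_cong[OF \<rho>]) (auto simp: f_eq)
    also have "\<dots> = (\<Sum>k\<le>degree p. coeff p k * (\<integral>\<zeta>. \<zeta> ^ k * cnj \<zeta> ^ N \<partial>\<rho>))"
      using int by simp
    also have "\<dots> = (\<Sum>k\<le>degree p. coeff p k * (if N \<le> k then \<integral>\<zeta>. \<zeta> ^ (k - N) \<partial>\<rho> else cnj (\<integral>\<zeta>. \<zeta> ^ (N - k) \<partial>\<rho>)))"
    proof (intro sum.cong refl arg_cong2[where f = "(*)"])
      fix k
      have *: "\<zeta> ^ k * cnj \<zeta> ^ N = (if N \<le> k then \<zeta> ^ (k - N) else cnj (\<zeta> ^ (N - k)))"
        if "norm \<zeta> = 1" for \<zeta>
      proof -
        have "\<zeta> * cnj \<zeta> = 1" using that by (simp add: complex_norm_square[symmetric])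
        then have 1: "\<zeta> ^ n * cnj \<zeta> ^ n = 1" for n by (metis power_mult_distrib power_one)
        show ?thesis
        proof (cases "N \<le> k")
          case True
          then have "\<zeta> ^ k = \<zeta> ^ (k - N) * \<zeta> ^ N" by (simp flip: power_add)
          then show ?thesis using True 1[of N] by (simp add: mult.assoc)
        next
          case False
          then have "cnj \<zeta> ^ N = cnj \<zeta> ^ k * cnj \<zeta> ^ (N - k)" by (simp flip: power_add)
          then show ?thesis using False 1[of k] by (simp flip: mult.assoc)
        qed
      qed
      have "(\<integral>\<zeta>. \<zeta> ^ k * cnj \<zeta> ^ N \<partial>\<rho>) = (\<integral>\<zeta>. (if N \<le> k then \<zeta> ^ (k - N) else cnj (\<zeta> ^ (N - k))) \<partial>\<rho>)"
        by (rule circle_prob_integral_cong[OF \<rho>]) (simp_all add: *)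
      also have "\<dots> = (if N \<le> k then \<integral>\<zeta>. \<zeta> ^ (k - N) \<partial>\<rho> else cnj (\<integral>\<zeta>. \<zeta> ^ (N - k) \<partial>\<rho>))"
        by (cases "N \<le> k") (simp_all only: if_True if_False Bochner_Integration.integral_cnj)
      finally show "(\<integral>\<zeta>. \<zeta> ^ k * cnj \<zeta> ^ N \<partial>\<rho>) = \<dots>" .
    qed
    finally show ?thesis .
  qed
  have "complex_of_real (\<integral>\<zeta>. f \<zeta> \<partial>\<nu>) = complex_of_real (\<integral>\<zeta>. f \<zeta> \<partial>\<nu>')"
    unfolding expand[OF \<nu>] expand[OF \<nu>'] moments ..
  then show ?thesis by simp
qed

lemma circle_prob_integral_continuous_eq:
  fixes f :: "complex \<Rightarrow> real"
  assumes \<nu>: "circle_prob \<nu>" and \<nu>': "circle_prob \<nu>'"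
    and moments: "\<And>n. (\<integral>\<zeta>. \<zeta> ^ n \<partial>\<nu>) = (\<integral>\<zeta>. \<zeta> ^ n \<partial>\<nu>')"
    and f: "continuous_on UNIV f"
  shows "(\<integral>\<zeta>. f \<zeta> \<partial>\<nu>) = (\<integral>\<zeta>. f \<zeta> \<partial>\<nu>')"
proof -
  have cint: "integrable \<rho> g" if \<rho>: "circle_prob \<rho>" and g: "continuous_on UNIV g"
    for \<rho> and g :: "complex \<Rightarrow> real"
  proof -
    have "compact (g ` sphere 0 1)"
      by (intro compact_continuous_image continuous_on_subset[OF g]) auto
    then obtain B where "\<And>\<zeta>. norm \<zeta> = 1 \<Longrightarrow> norm (g \<zeta>) \<le> B"
      using compact_imp_bounded by (force simp: bounded_iff)
    then show ?thesis
      by (intro circle_prob_integrable[OF \<rho> borel_measurable_continuous_onI[OF g]])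
  qed
  have "\<bar>(\<integral>\<zeta>. f \<zeta> \<partial>\<nu>) - (\<integral>\<zeta>. f \<zeta> \<partial>\<nu>')\<bar> \<le> e" if "e > 0" for e
  proof -
    obtain g where g: "real_polynomial_function g" and
      close: "\<And>\<zeta>. \<zeta> \<in> sphere 0 1 \<Longrightarrow> \<bar>f \<zeta> - g \<zeta>\<bar> < e / 2"
      using Stone_Weierstrass_real_polynomial_function[of "sphere 0 1" f "e / 2"] \<open>e > 0\<close>
        continuous_on_subset[OF f] by auto
    have gc: "continuous_on UNIV g"
      using g by (simp add: continuous_on_polymonial_function real_polynomial_function_eq)
    have bnd: "\<bar>(\<integral>\<zeta>. f \<zeta> \<partial>\<rho>) - (\<integral>\<zeta>. g \<zeta> \<partial>\<rho>)\<bar> \<le> e / 2" if \<rho>: "circle_prob \<rho>" for \<rho>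
    proof -
      interpret prob_space \<rho> using \<rho> by (rule circle_prob_imp_prob_space)
      have "\<bar>\<integral>\<zeta>. f \<zeta> - g \<zeta> \<partial>\<rho>\<bar> \<le> (\<integral>\<zeta>. \<bar>f \<zeta> - g \<zeta>\<bar> \<partial>\<rho>)" by (rule integral_abs_bound)
      also have "\<dots> \<le> (\<integral>\<zeta>. e / 2 \<partial>\<rho>)"
      proof (rule integral_mono_AE)
        show "integrable \<rho> (\<lambda>\<zeta>. \<bar>f \<zeta> - g \<zeta>\<bar>)"
          by (intro integrable_abs Bochner_Integration.integrable_diff cint[OF \<rho>] f gc)
        show "AE \<zeta> in \<rho>. \<bar>f \<zeta> - g \<zeta>\<bar> \<le> e / 2"
          using circle_prob_AE_norm[OF \<rho>]
          by eventually_elim (use close in \<open>auto intro!: less_imp_le\<close>)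
      qed simp
      finally show ?thesis by (simp add: cint[OF \<rho>] f gc prob_space)
    qed
    show ?thesis
      using bnd[OF \<nu>] bnd[OF \<nu>'] circle_prob_integral_real_polynomial_eq[OF \<nu> \<nu>' moments g]
      by linarith
  qed
  then have "\<bar>(\<integral>\<zeta>. f \<zeta> \<partial>\<nu>) - (\<integral>\<zeta>. f \<zeta> \<partial>\<nu>')\<bar> \<le> 0"
    by (metis field_le_epsilon add_0)
  then show ?thesis by simp
qed

text \<open>Closed sets form a generating system stable under intersection, and the indicator of a
  closed set is a pointwise limit of bounded continuous functions, for which the integrals already
  agree.\<close>

lemma circle_prob_eqI:
  assumes \<nu>: "circle_prob \<nu>" and \<nu>': "circle_prob \<nu>'"
    and moments: "\<And>n. (\<integral>\<zeta>. \<zeta> ^ n \<partial>\<nu>) = (\<integral>\<zeta>. \<zeta> ^ n \<partial>\<nu>')"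
  shows "\<nu> = \<nu>'"
proof (rule measure_eqI_generator_eq)
  show "Int_stable (Collect closed :: complex set set)" by (auto simp: Int_stable_def)
  show "sets \<nu> = sigma_sets UNIV (Collect closed)" "sets \<nu>' = sigma_sets UNIV (Collect closed)"
    using circle_prob_sets[OF \<nu>] circle_prob_sets[OF \<nu>'] by (auto simp: borel_eq_closed)
  show "range (\<lambda>_. UNIV) \<subseteq> (Collect closed :: complex set set)" by auto
  show "emeasure \<nu> UNIV \<noteq> \<infinity>"
    using \<nu> by (simp add: circle_prob_def prob_space_def finite_measure.emeasure_eq_measure)
  fix S :: "complex set" assume "S \<in> Collect closed"
  then have S: "closed S" by simp
  show "emeasure \<nu> S = emeasure \<nu>' S"
  proof (cases "S = {}")
    case False
    \<comment> \<open>A continuous cutoff that is 1 on \<open>S\<close> and vanishes at distance 1 /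
      n and beyond. It needs \<open>S\<close> nonempty, since \<open>infdist\<close> to the empty
      set is 0 by convention.\<close>
    define h where "h n \<zeta> = max 0 (1 - real n * infdist \<zeta> S)" for n \<zeta>
    have hc: "continuous_on UNIV (h n)" for n
      unfolding h_def by (intro continuous_intros)
    have lim: "(\<lambda>n. h n \<zeta>) \<longlonglongrightarrow> indicat_real S \<zeta>" for \<zeta>
    proof (cases "\<zeta> \<in> S")
      case True
      then show ?thesis by (simp add: h_def)
    next
      case F: False
      then have "infdist \<zeta> S > 0"
        using S False in_closed_iff_infdist_zero infdist_nonneg by (metis less_eq_real_def)
      then obtain N where "1 < real N * infdist \<zeta> S" using reals_Archimedean3 by blast
      have "h n \<zeta> = 0" if "n \<ge> N" for n
      proof -
        have "real N * infdist \<zeta> S \<le> real n * infdist \<zeta> S"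
          using that by (intro mult_right_mono) (auto simp: infdist_nonneg)
        then show ?thesis using \<open>1 < _\<close> by (simp add: h_def)
      qed
      then show ?thesis
        using F by (auto intro!: tendsto_eventually eventually_sequentiallyI[of N])
    qed
    have meas: "(\<lambda>n. \<integral>\<zeta>. h n \<zeta> \<partial>\<rho>) \<longlonglongrightarrow> measure \<rho> S" if \<rho>: "circle_prob \<rho>" for \<rho>
    proof -
      interpret prob_space \<rho> using \<rho> by (rule circle_prob_imp_prob_space)
      note [measurable_cong] = circle_prob_sets[OF \<rho>]
      have [measurable]: "S \<in> sets borel" using S by auto
      have [measurable]: "h n \<in> borel_measurable borel" for n
        by (rule borel_measurable_continuous_onI[OF hc])
      have "norm (h n \<zeta>) \<le> 1" for n \<zeta>
        by (simp add: h_def infdist_nonneg)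
      then have "(\<lambda>n. \<integral>\<zeta>. h n \<zeta> \<partial>\<rho>) \<longlonglongrightarrow> (\<integral>\<zeta>. indicat_real S \<zeta> \<partial>\<rho>)"
        by (intro integral_dominated_convergence[where w = "\<lambda>_. 1"]) (use lim in auto)
      then show ?thesis using sets.sets_into_space[of S \<rho>] by (simp add: Int_absorb2)
    qed
    have meas_eq: "measure \<nu> S = measure \<nu>' S"
    proof (rule LIMSEQ_unique[OF meas[OF \<nu>]])
      show "(\<lambda>n. \<integral>\<zeta>. h n \<zeta> \<partial>\<nu>) \<longlonglongrightarrow> measure \<nu>' S"
        using meas[OF \<nu>'] circle_prob_integral_continuous_eq[OF \<nu> \<nu>' moments hc] by simp
    qed
    then show ?thesis
      using \<nu> \<nu>' by (simp add: circle_prob_def prob_space_def finite_measure.emeasure_eq_measure)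
  qed auto
qed auto

text \<open>The difference of the two functions \<open>chi_T\<close> vanishes on the punctured disc,
  hence at 0 by continuity. A power series with a nonzero coefficient has isolated zeros, so all
  moments agree.\<close>

lemma circle_prob_eqI_psi_T:
  assumes \<nu>: "circle_prob \<nu>" and \<nu>': "circle_prob \<nu>'"
    and psi: "\<And>q. 0 < norm q \<Longrightarrow> norm q < 1 \<Longrightarrow> psi_T \<nu> q = psi_T \<nu>' q"
  shows "\<nu> = \<nu>'"
proof (rule circle_prob_eqI[OF \<nu> \<nu>'])
  define m where "m n = (\<integral>\<zeta>. \<zeta> ^ Suc n \<partial>\<nu>) - (\<integral>\<zeta>. \<zeta> ^ Suc n \<partial>\<nu>')" for n
  define g where "g q = chi_T \<nu> q - chi_T \<nu>' q" for q
  have sums: "(\<lambda>n. m n * (q - 0) ^ n) sums g q" if "norm (q - 0) < 1" for q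
    using sums_diff[OF chi_T_sums[OF \<nu>, of q] chi_T_sums[OF \<nu>', of q]] that
    by (simp add: m_def g_def algebra_simps)
  have g0: "g q = 0" if "0 < norm q" "norm q < 1" for q
    using psi[OF that] that by (simp add: psi_T_eq_chi_T g_def)
  have "g holomorphic_on ball 0 1"
    unfolding g_def by (intro holomorphic_intros chi_T_holomorphic \<nu> \<nu>')
  then have "isCont g 0"
    by (intro continuous_on_interior[OF holomorphic_on_imp_continuous_on]) auto
  moreover have "(g \<longlongrightarrow> 0) (at 0)"
    by (rule tendsto_eventually)
       (use g0 in \<open>auto simp: eventually_at dist_norm intro!: exI[of _ 1]\<close>)
  ultimately have "g 0 = 0" by (auto simp: isCont_def intro: LIM_unique)
  moreover have "g 0 = m 0" using sums[of 0] by simp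
  ultimately have m0: "m 0 = 0" by simp
  have m: "m n = 0" for n
  proof (rule ccontr)
    assume "m n \<noteq> 0"
    with m0 have "n > 0" by (cases n) auto
    obtain s where s: "0 < s" "\<And>q. q \<in> cball 0 s - {0} \<Longrightarrow> g q \<noteq> 0"
      using powser_0_nonzero[OF zero_less_one sums \<open>g 0 = 0\<close> \<open>m n \<noteq> 0\<close> \<open>n > 0\<close>] by blast
    \<comment> \<open>A point lying both in the punctured disc where \<open>g\<close> has no zero
      and in the unit disc where \<open>g\<close> vanishes.\<close>
    define q where "q = complex_of_real (min s (1/2))"
    have "norm q = min s (1/2)" using s by (simp add: q_def)
    moreover have "q \<noteq> 0" using s(1) by (auto simp: q_def min_def)
    moreover have "min s (1 / 2) < 1" by simp
    ultimately show False using s(1) s(2)[of q] g0[of q] by simp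
  qed
  show "(\<integral>\<zeta>. \<zeta> ^ n \<partial>\<nu>) = (\<integral>\<zeta>. \<zeta> ^ n \<partial>\<nu>')" for n
  proof (cases n)
    case 0
    then show ?thesis
      using prob_space.prob_space[OF circle_prob_imp_prob_space[OF \<nu>]]
        prob_space.prob_space[OF circle_prob_imp_prob_space[OF \<nu>']] by simp
  next
    case (Suc k)
    then show ?thesis using m[of k] unfolding m_def by (simp only: right_minus_eq)
  qed
qed

section \<open>Partial fractions of the cotangent\<close>

text \<open>This is the logarithmic derivative of the reflection formula for Gamma. With the entire
  function \<open>rGamma\<close> the formula holds at every point, so both sides can be
  differentiated and the results compared.\<close>

lemma Digamma_reflection:
  assumes "(z :: complex) \<notin> \<int>"
  shows "Digamma (1 - z) - Digamma z = of_real pi * cot (of_real pi * z)"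
proof -
  have z1: "1 - z \<notin> \<int>" using assms by (metis Ints_1 Ints_diff diff_diff_eq2 add_diff_cancel_left')
  have nz: "z \<notin> \<int>\<^sub>\<le>\<^sub>0" "1 - z \<notin> \<int>\<^sub>\<le>\<^sub>0" using assms z1 nonpos_Ints_subset_Ints by auto
  have s: "sin (of_real pi * z) \<noteq> 0"
    using rGamma_reflection_complex[of z] nz by (auto simp: rGamma_eq_zero_iff)
  have R: "rGamma z * rGamma (1 - z) = sin (of_real pi * z) / of_real pi" for z :: complex
    by (rule rGamma_reflection_complex)
  have "((\<lambda>z. rGamma z * rGamma (1 - z)) has_field_derivative
      (- rGamma z * Digamma z) * rGamma (1 - z) + (- rGamma (1 - z) * Digamma (1 - z) * (-1)) * rGamma z) (at z)"
    by (intro DERIV_mult DERIV_chain2[of rGamma, OF has_field_derivative_rGamma_no_nonpos_int]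
        has_field_derivative_rGamma_no_nonpos_int nz) (auto intro!: derivative_eq_intros)
  moreover have "((\<lambda>z. sin (of_real pi * z) / of_real pi) has_field_derivative cos (of_real pi * z)) (at z)"
    by (auto intro!: derivative_eq_intros)
  ultimately have "(- rGamma z * Digamma z) * rGamma (1 - z)
      + (- rGamma (1 - z) * Digamma (1 - z) * (-1)) * rGamma z = cos (of_real pi * z)"
    unfolding R by (rule DERIV_unique)
  then have "(rGamma z * rGamma (1 - z)) * (Digamma (1 - z) - Digamma z) = cos (of_real pi * z)"
    by (simp add: algebra_simps)
  then show ?thesis using s unfolding R by (simp add: cot_def field_simps)
qed

text \<open>On the upper half-plane this is i cot (u / 2). The exponential form is chosen because
  the integrand of 1 + 2 \<psi> has it, with exp (i u) equal to q \<zeta>.\<close>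

definition half_cot :: "complex \<Rightarrow> complex" where
  "half_cot u = (1 + exp (\<i> * u)) / (1 - exp (\<i> * u))"

lemma norm_exp_i_less_one: "Im u > 0 \<Longrightarrow> norm (exp (\<i> * u)) < 1"
  by simp

lemma half_cot_eq_cot:
  assumes "Im u > 0"
  shows "half_cot u = \<i> * cot (u / 2)"
proof -
  let ?a = "exp (\<i> * (u / 2))" and ?b = "exp (- (\<i> * (u / 2)))"
  have ab: "?a * ?b = 1" by (simp add: exp_minus)
  have e: "exp (\<i> * u) = ?a * ?a" by (simp flip: exp_add)
  have nz: "?a \<noteq> 0" "?b \<noteq> 0" by auto
  have ne: "exp (\<i> * u) \<noteq> 1" using norm_exp_i_less_one[OF assms] by (metis norm_one less_irrefl)
  have "sin (u / 2) = (?a - ?b) / (2 * \<i>)" "cos (u / 2) = (?a + ?b) / 2"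
    by (simp_all add: sin_exp_eq' cos_exp_eq minus_mult_right)
  then have ic: "\<i> * cot (u / 2) = \<i> * (((?a + ?b) / 2) / ((?a - ?b) / (2 * \<i>)))"
    by (simp only: cot_def)
  have d: "1 - exp (\<i> * u) = - ?a * (?a - ?b)" "1 + exp (\<i> * u) = ?a * (?a + ?b)"
    using ab by (simp_all add: e algebra_simps)
  have alg: "x / (- y) = \<i> * ((x / 2) / (y / (2 * \<i>)))" for x y :: complex
    by (cases "y = 0") (simp_all add: field_simps)
  have "half_cot u = (?a * (?a + ?b)) / (?a * (- (?a - ?b)))"
    unfolding half_cot_def d by (simp only: mult_minus_left mult_minus_right)
  also have "\<dots> = (?a + ?b) / (- (?a - ?b))"
    using nz(1) by (rule mult_divide_mult_cancel_left)
  also have "\<dots> = \<i> * (((?a + ?b) / 2) / ((?a - ?b) / (2 * \<i>)))"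
    by (rule alg)
  finally show ?thesis unfolding ic .
qed

text \<open>The bound depends on Im u alone. It therefore gives a constant majorant along horizontal
  lines as well as the limit 1 at i times infinity.\<close>

lemma norm_half_cot_minus_one:
  assumes "Im u > 0"
  shows "norm (half_cot u - 1) \<le> 2 * exp (- Im u) / (1 - exp (- Im u))"
proof -
  let ?e = "exp (\<i> * u)"
  have n: "norm ?e = exp (- Im u)" by simp
  have lt: "exp (- Im u) < 1" using assms by simp
  have "norm (1 - ?e) \<ge> 1 - exp (- Im u)" using norm_triangle_ineq2[of 1 ?e] n by simp
  moreover have "1 - ?e \<noteq> 0" using n lt by (metis norm_one less_irrefl eq_iff_diff_eq_0)
  moreover have "half_cot u - 1 = 2 * ?e / (1 - ?e)"
    using \<open>1 - ?e \<noteq> 0\<close> by (simp add: half_cot_def field_simps)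
  ultimately show ?thesis using n lt
    by (auto simp: norm_divide norm_mult intro!: divide_left_mono mult_pos_pos)
qed

text \<open>The half-open range pairs each index n \<ge> 0 with -1 - n, which is how the series of
  Digamma at z and at 1 - z combine. Summation over growing symmetric blocks is essential, as the
  series does not converge absolutely.\<close>

definition pole_sum :: "nat \<Rightarrow> complex \<Rightarrow> complex" where
  "pole_sum m u = (\<Sum>k\<in>{- int m..<int m}. 2 * \<i> / (u + 2 * of_real pi * of_int k))"

lemma sum_symmetric_int_interval:
  fixes f :: "int \<Rightarrow> 'a :: comm_monoid_add"
  shows "(\<Sum>k\<in>{- int m..<int m}. f k) = (\<Sum>n<m. f (int n) + f (- 1 - int n))"
proof (induction m)
  case (Suc m)
  have "{- int (Suc m)..<int (Suc m)} = insert (int m) (insert (- 1 - int m) {- int m..<int m})"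
    by auto
  then show ?case using Suc by (simp add: add_ac)
qed simp

lemma pole_sum_tendsto:
  assumes u: "Im u > 0"
  shows "(\<lambda>m. pole_sum m u) \<longlonglongrightarrow> half_cot u"
proof -
  define z where "z = u / of_real (2 * pi)"
  have u_eq: "u = 2 * of_real pi * z" by (simp add: z_def)
  have "Im z > 0" using u unfolding z_def Im_divide_of_real by simp
  have zint: "z \<notin> \<int>"
  proof
    assume "z \<in> \<int>"
    then have "Im z = 0" by (auto elim: Ints_cases)
    with \<open>Im z > 0\<close> show False by simp
  qed
  have nz: "z + of_int k \<noteq> 0" for k
  proof
    assume "z + of_int k = 0"
    then have "z = of_int (- k)" by (simp add: add_eq_0_iff2)
    with zint show False by (metis Ints_of_int)
  qed
  have "z \<noteq> 0" "1 - z \<noteq> 0" using nz[of 0] nz[of "-1"] by auto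
  \<comment> \<open>The logarithms in the two limits cancel. The factor i / \<pi> appears because 2
    i / (u + 2 \<pi> k) = (i / \<pi>) / (z + k) for u = 2 \<pi> z.\<close>
  have "(\<lambda>m. (of_real (ln (real m)) - (\<Sum>n<m. inverse (1 - z + of_nat n)))
      - (of_real (ln (real m)) - (\<Sum>n<m. inverse (z + of_nat n)))) \<longlonglongrightarrow> Digamma (1 - z) - Digamma z"
    by (intro tendsto_diff Digamma_LIMSEQ) fact+
  then have "(\<lambda>m. (\<i> / of_real pi) * ((of_real (ln (real m)) - (\<Sum>n<m. inverse (1 - z + of_nat n)))
      - (of_real (ln (real m)) - (\<Sum>n<m. inverse (z + of_nat n))))) \<longlonglongrightarrow>
      (\<i> / of_real pi) * (of_real pi * cot (of_real pi * z))"
    unfolding Digamma_reflection[OF zint] by (rule tendsto_mult_left)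
  also have "(\<i> / of_real pi) * (of_real pi * cot (of_real pi * z)) = half_cot u"
    unfolding half_cot_eq_cot[OF u] by (simp add: u_eq)
  also have "(\<lambda>m. (\<i> / of_real pi) * ((of_real (ln (real m)) - (\<Sum>n<m. inverse (1 - z + of_nat n)))
      - (of_real (ln (real m)) - (\<Sum>n<m. inverse (z + of_nat n))))) = (\<lambda>m. pole_sum m u)"
  proof
    fix m
    have "(of_real (ln (real m)) - (\<Sum>n<m. inverse (1 - z + of_nat n)))
      - (of_real (ln (real m)) - (\<Sum>n<m. inverse (z + of_nat n)))
      = (\<Sum>n<m. inverse (z + of_nat n) - inverse (1 - z + of_nat n))"
      by (simp add: sum_subtractf)
    also have "\<dots> = (\<Sum>n<m. inverse (z + of_int (int n)) + inverse (z + of_int (- 1 - int n)))"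
    proof (rule sum.cong[OF refl])
      fix n
      have "1 - z + of_nat n = - (z + of_int (- 1 - int n))" by simp
      then show "inverse (z + of_nat n) - inverse (1 - z + of_nat n)
          = inverse (z + of_int (int n)) + inverse (z + of_int (- 1 - int n))"
        by (simp only: inverse_minus_eq of_int_of_nat_eq diff_minus_eq_add)
    qed
    also have "\<dots> = (\<Sum>k\<in>{- int m..<int m}. inverse (z + of_int k))"
      by (rule sum_symmetric_int_interval[symmetric])
    finally show "(\<i> / of_real pi) * ((of_real (ln (real m)) - (\<Sum>n<m. inverse (1 - z + of_nat n)))
      - (of_real (ln (real m)) - (\<Sum>n<m. inverse (z + of_nat n)))) = pole_sum m u"
      by (simp only: pole_sum_def u_eq distrib_left[symmetric] sum_distrib_left)
         (simp add: inverse_eq_divide)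
  qed
  finally show ?thesis .
qed

lemma shift_nonzero: "Im u > 0 \<Longrightarrow> u + 2 * of_real pi * of_int k \<noteq> 0"
  by (auto simp: complex_eq_iff)

text \<open>The real part of 2 i / w is 2 Im w / |w|^2. All terms of the real part are thus
  nonnegative, and the truncations increase to their limit.\<close>

lemma pole_sum_norm_bound:
  assumes "Im u > 0"
  shows "(\<Sum>k\<in>{- int m..<int m}. 2 * Im u / (norm (u + 2 * of_real pi * of_int k))\<^sup>2) \<le> Re (half_cot u)"
proof -
  have Re_eq: "Re (pole_sum m u) =
      (\<Sum>k\<in>{- int m..<int m}. 2 * Im u / (norm (u + 2 * of_real pi * of_int k))\<^sup>2)" for m
    unfolding pole_sum_def Re_sum
    by (intro sum.cong refl) (simp add: Re_divide cmod_power2)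
  have lim: "(\<lambda>m. Re (pole_sum m u)) \<longlonglongrightarrow> Re (half_cot u)"
    by (intro tendsto_Re pole_sum_tendsto assms)
  have "incseq (\<lambda>m. Re (pole_sum m u))"
    unfolding incseq_def Re_eq
    by (intro allI impI sum_mono2) (use assms in auto)
  from incseq_le[OF this lim, of m] show ?thesis unfolding Re_eq .
qed

text \<open>In a difference of two simple poles the decay becomes quadratic, and 2 a b \<le> a^2 +
  b^2 reduces it to \<open>pole_sum_norm_bound\<close> at the two points. The point of the estimate
  is that it does not depend on \<open>m\<close>.\<close>

lemma pole_sum_diff_bound:
  assumes u: "Im u > 0" and v: "Im v > 0"
  shows "norm (pole_sum m u - pole_sum m v)
      \<le> norm (u - v) * (Re (half_cot u) / (2 * Im u) + Re (half_cot v) / (2 * Im v))"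
proof -
  let ?I = "{- int m..<int m}"
  let ?a = "\<lambda>k. norm (u + 2 * of_real pi * of_int k)" and ?b = "\<lambda>k. norm (v + 2 * of_real pi * of_int k)"
  have S: "(\<Sum>k\<in>?I. 1 / (norm (w + 2 * of_real pi * of_int k))\<^sup>2) \<le> Re (half_cot w) / (2 * Im w)"
    if "Im w > 0" for w
    using pole_sum_norm_bound[OF that, of m] that
    by (simp add: pos_le_divide_eq sum_distrib_left mult.commute)
  have "norm (pole_sum m u - pole_sum m v)
      \<le> (\<Sum>k\<in>?I. norm (2 * \<i> / (u + 2 * of_real pi * of_int k) - 2 * \<i> / (v + 2 * of_real pi * of_int k)))"
    unfolding pole_sum_def sum_subtractf[symmetric] by (rule norm_sum)
  also have "\<dots> \<le> (\<Sum>k\<in>?I. norm (u - v) * (1 / (?a k)\<^sup>2 + 1 / (?b k)\<^sup>2))"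
  proof (rule sum_mono)
    fix k
    have nz: "u + 2 * of_real pi * of_int k \<noteq> 0" "v + 2 * of_real pi * of_int k \<noteq> 0"
      using shift_nonzero u v by auto
    then have "2 * \<i> / (u + 2 * of_real pi * of_int k) - 2 * \<i> / (v + 2 * of_real pi * of_int k)
        = 2 * \<i> * (v - u) / ((u + 2 * of_real pi * of_int k) * (v + 2 * of_real pi * of_int k))"
      by (simp add: field_simps)
    then have "norm (2 * \<i> / (u + 2 * of_real pi * of_int k) - 2 * \<i> / (v + 2 * of_real pi * of_int k))
        = norm (u - v) * (2 * (1 / ?a k) * (1 / ?b k))"
      by (simp add: norm_divide norm_mult norm_minus_commute)
    also have "\<dots> \<le> norm (u - v) * ((1 / ?a k)\<^sup>2 + (1 / ?b k)\<^sup>2)"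
      by (intro mult_left_mono sum_squares_bound) auto
    finally show "norm (2 * \<i> / (u + 2 * of_real pi * of_int k) - 2 * \<i> / (v + 2 * of_real pi * of_int k))
        \<le> norm (u - v) * (1 / (?a k)\<^sup>2 + 1 / (?b k)\<^sup>2)" by (simp add: power_one_over)
  qed
  also have "\<dots> = norm (u - v) * ((\<Sum>k\<in>?I. 1 / (?a k)\<^sup>2) + (\<Sum>k\<in>?I. 1 / (?b k)\<^sup>2))"
    by (simp only: sum_distrib_left[symmetric] sum.distrib)
  also have "\<dots> \<le> norm (u - v) * (Re (half_cot u) / (2 * Im u) + Re (half_cot v) / (2 * Im v))"
    by (intro mult_left_mono add_mono S u v) auto
  finally show ?thesis .
qed

section \<open>Cauchy transforms on the line\<close>

lemma real_prob_imp_prob_space: "real_prob \<mu> \<Longrightarrow> prob_space \<mu>"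
  and real_prob_sets: "real_prob \<mu> \<Longrightarrow> sets \<mu> = sets borel"
  by (auto simp: real_prob_def)

lemma real_prob_measurable:
  "real_prob \<mu> \<Longrightarrow> f \<in> borel_measurable borel \<Longrightarrow> f \<in> borel_measurable \<mu>"
  by (simp add: measurable_cong_sets[OF real_prob_sets refl])

lemma real_prob_integrable:
  fixes f :: "real \<Rightarrow> 'a :: {banach, second_countable_topology}"
  assumes \<mu>: "real_prob \<mu>" and f: "f \<in> borel_measurable borel" and B: "\<And>x. norm (f x) \<le> B"
  shows "integrable \<mu> f"
proof -
  interpret prob_space \<mu> using \<mu> by (rule real_prob_imp_prob_space)
  show ?thesis
    by (rule integrable_const_bound[where B = B]) (use B real_prob_measurable[OF \<mu> f] in auto)
qed

lemma norm_diff_of_real_ge: "\<bar>Im z\<bar> \<le> norm (z - complex_of_real x)"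
  using abs_Im_le_cmod[of "z - complex_of_real x"] by simp

lemma norm_resolvent_le:
  assumes "Im z > 0"
  shows "norm (1 / (z - complex_of_real x)) \<le> 1 / Im z"
  using norm_diff_of_real_ge[of z x] assms
  by (simp add: norm_divide divide_simps)

lemma integrable_resolvent:
  assumes "real_prob \<mu>" "Im z > 0"
  shows "integrable \<mu> (\<lambda>x. 1 / (z - complex_of_real x))"
  by (rule real_prob_integrable[OF assms(1) _ norm_resolvent_le[OF assms(2)]]) measurable

lemma Im_cauchy_G_neg:
  assumes \<mu>: "real_prob \<mu>" and z: "Im z > 0"
  shows "Im (cauchy_G \<mu> z) < 0"
proof -
  interpret prob_space \<mu> using \<mu> by (rule real_prob_imp_prob_space)
  note int = integrable_resolvent[OF \<mu> z]
  let ?f = "\<lambda>x. - Im (1 / (z - complex_of_real x))"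
  have pos: "?f x > 0" for x
    using z by (auto simp: Im_divide complex_eq_iff intro!: divide_pos_pos sum_power2_gt_zero_iff[THEN iffD2])
  have fint: "integrable \<mu> ?f"
    by (intro Bochner_Integration.integrable_minus integrable_Im int)
  have "0 < (\<integral>x. ?f x \<partial>\<mu>)"
  proof (rule ccontr)
    assume "\<not> ?thesis"
    moreover have "0 \<le> (\<integral>x. ?f x \<partial>\<mu>)" by (rule integral_nonneg_AE) (use pos in \<open>auto intro: less_imp_le\<close>)
    ultimately have "(\<integral>x. ?f x \<partial>\<mu>) = 0" by linarith
    then have "AE x in \<mu>. ?f x = 0"
      by (subst (asm) integral_nonneg_eq_0_iff_AE[OF fint]) (use pos in \<open>auto intro: less_imp_le\<close>)
    then have "AE x in \<mu>. False" using pos by (auto elim!: eventually_mono simp: less_le)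
    then show False by simp
  qed
  also have "(\<integral>x. ?f x \<partial>\<mu>) = - Im (cauchy_G \<mu> z)"
    unfolding cauchy_G_def integral_minus integral_Im[OF int] ..
  finally show ?thesis by simp
qed

lemma cauchy_G_nonzero: "real_prob \<mu> \<Longrightarrow> Im z > 0 \<Longrightarrow> cauchy_G \<mu> z \<noteq> 0"
  using Im_cauchy_G_neg by fastforce

lemma Im_cauchy_F_pos:
  assumes "real_prob \<mu>" "Im z > 0"
  shows "Im (cauchy_F \<mu> z) > 0"
  using Im_cauchy_G_neg[OF assms] cauchy_G_nonzero[OF assms]
  by (auto simp: cauchy_F_def Im_divide complex_eq_iff divide_neg_pos
        intro!: divide_neg_pos sum_power2_gt_zero_iff[THEN iffD2])

lemma cauchy_G_diff_le:
  assumes \<mu>: "real_prob \<mu>" and z: "Im z > 0" and w: "Im w > 0"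
  shows "norm (cauchy_G \<mu> z - cauchy_G \<mu> w) \<le> norm (z - w) / (Im z * Im w)"
proof -
  interpret prob_space \<mu> using \<mu> by (rule real_prob_imp_prob_space)
  note int = integrable_resolvent[OF \<mu> z] integrable_resolvent[OF \<mu> w]
  have bnd: "norm (1 / (z - complex_of_real x) - 1 / (w - complex_of_real x)) \<le> norm (z - w) / (Im z * Im w)" for x
  proof -
    have "z - of_real x \<noteq> 0" "w - of_real x \<noteq> 0" using z w by (auto simp: complex_eq_iff)
    then have "1 / (z - complex_of_real x) - 1 / (w - complex_of_real x)
        = (w - z) * (1 / (z - complex_of_real x)) * (1 / (w - complex_of_real x))"
      by (simp add: field_simps)
    also have "norm \<dots> \<le> norm (w - z) * (1 / Im z) * (1 / Im w)"
      unfolding norm_mult by (intro mult_mono norm_resolvent_le z w mult_nonneg_nonneg) (use z in auto)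
    finally show ?thesis by (simp add: norm_minus_commute)
  qed
  have "cauchy_G \<mu> z - cauchy_G \<mu> w = (\<integral>x. 1 / (z - complex_of_real x) - 1 / (w - complex_of_real x) \<partial>\<mu>)"
    unfolding cauchy_G_def by (rule Bochner_Integration.integral_diff[OF int, symmetric])
  also have "norm \<dots> \<le> (\<integral>x. norm (z - w) / (Im z * Im w) \<partial>\<mu>)"
    by (rule Bochner_Integration.integral_norm_bound_integral)
       (use bnd Bochner_Integration.integrable_diff[OF int] in auto)
  finally show ?thesis by (simp add: prob_space)
qed

lemma isCont_cauchy_G:
  assumes \<mu>: "real_prob \<mu>" and z: "Im z > 0"
  shows "isCont (cauchy_G \<mu>) z"
proof -
  have "\<forall>\<^sub>F w in at z. Im w > 0"
    by (rule order_tendstoD(1)[OF _ z]) (intro tendsto_intros)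
  then have "\<forall>\<^sub>F w in at z. norm (cauchy_G \<mu> w - cauchy_G \<mu> z) \<le> norm (w - z) / (Im w * Im z)"
    by eventually_elim (rule cauchy_G_diff_le[OF \<mu> _ z])
  moreover have "((\<lambda>w. norm (w - z) / (Im w * Im z)) \<longlongrightarrow> norm (z - z) / (Im z * Im z)) (at z)"
    using z by (intro tendsto_intros) auto
  then have "((\<lambda>w. norm (w - z) / (Im w * Im z)) \<longlongrightarrow> 0) (at z)" by simp
  ultimately have "((\<lambda>w. norm (cauchy_G \<mu> w - cauchy_G \<mu> z)) \<longlongrightarrow> 0) (at z)"
    by (intro real_tendsto_sandwich[where f = "\<lambda>_. 0" and g = "\<lambda>w. norm (cauchy_G \<mu> w - cauchy_G \<mu> z)"]) auto
  then show ?thesis by (simp add: isCont_def tendsto_norm_zero_iff LIM_zero_iff)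
qed

lemma isCont_cauchy_F: "real_prob \<mu> \<Longrightarrow> Im z > 0 \<Longrightarrow> isCont (cauchy_F \<mu>) z"
  unfolding cauchy_F_def by (intro continuous_intros isCont_cauchy_G cauchy_G_nonzero)

text \<open>The integrand is bounded by 1 and tends to 1 pointwise, so the limit is the total mass.
  Through \<open>cauchy_F_asymptotics\<close> this fixes the growth of F along the imaginary
  axis.\<close>

lemma cauchy_G_asymptotics:
  assumes \<mu>: "real_prob \<mu>"
  shows "((\<lambda>y. \<i> * complex_of_real y * cauchy_G \<mu> (\<i> * complex_of_real y)) \<longlongrightarrow> 1) at_top"
proof -
  interpret prob_space \<mu> using \<mu> by (rule real_prob_imp_prob_space)
  let ?f = "\<lambda>y x. \<i> * complex_of_real y * (1 / (\<i> * complex_of_real y - complex_of_real x))"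
  have bnd: "norm (?f y x) \<le> 1" if "y > 0" for y x
  proof -
    have "norm (?f y x) = y * norm (1 / (\<i> * complex_of_real y - complex_of_real x))"
      using that by (simp add: norm_mult norm_divide)
    also have "\<dots> \<le> y * (1 / Im (\<i> * complex_of_real y))"
      using that by (intro mult_left_mono norm_resolvent_le) auto
    finally show ?thesis using that by simp
  qed
  have lim: "((\<lambda>y. ?f y x) \<longlongrightarrow> 1) at_top" for x
  proof -
    have "((\<lambda>y. 1 / (1 + \<i> * complex_of_real (x / y))) \<longlongrightarrow> 1 / (1 + \<i> * complex_of_real 0)) at_top"
      by (intro tendsto_intros real_tendsto_divide_at_top[OF tendsto_const] filterlim_ident) auto
    moreover have "\<forall>\<^sub>F y in at_top. ?f y x = 1 / (1 + \<i> * complex_of_real (x / y))"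
      using eventually_gt_at_top[of 0]
    proof eventually_elim
      case (elim y)
      have "\<i> * complex_of_real y - complex_of_real x = (\<i> * complex_of_real y) * (1 + \<i> * complex_of_real (x / y))"
        using elim by (simp add: field_simps)
      then show ?case using elim by simp
    qed
    ultimately show ?thesis by (simp add: tendsto_cong)
  qed
  have meas: "(\<lambda>x. ?f y x) \<in> borel_measurable \<mu>" for y
    by (rule real_prob_measurable[OF \<mu>]) measurable
  have "((\<lambda>y. \<integral>x. ?f y x \<partial>\<mu>) \<longlongrightarrow> (\<integral>x. 1 \<partial>\<mu>)) at_top"
  proof (rule integral_dominated_convergence_at_top[where w = "\<lambda>_. 1"])
    show "\<forall>\<^sub>F y in at_top. AE x in \<mu>. norm (?f y x) \<le> 1"
      using eventually_gt_at_top[of 0] by eventually_elim (use bnd in auto)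
    show "AE x in \<mu>. ((\<lambda>y. ?f y x) \<longlongrightarrow> 1) at_top" using lim by auto
  qed (use meas in auto)
  then show ?thesis
    unfolding cauchy_G_def integral_mult_right_zero by (simp only: lebesgue_integral_const prob_space scaleR_one)
qed

lemma cauchy_F_asymptotics:
  assumes \<mu>: "real_prob \<mu>"
  shows "((\<lambda>y. Im (cauchy_F \<mu> (\<i> * complex_of_real y)) / y) \<longlongrightarrow> 1) at_top"
proof -
  have "((\<lambda>y. Im (\<i> * inverse (\<i> * complex_of_real y * cauchy_G \<mu> (\<i> * complex_of_real y)))) \<longlongrightarrow> Im (\<i> * inverse 1)) at_top"
    by (intro tendsto_intros cauchy_G_asymptotics[OF \<mu>]) auto
  moreover have "\<forall>\<^sub>F y in at_top. Im (\<i> * inverse (\<i> * complex_of_real y * cauchy_G \<mu> (\<i> * complex_of_real y)))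
      = Im (cauchy_F \<mu> (\<i> * complex_of_real y)) / y"
    using eventually_gt_at_top[of 0]
  proof eventually_elim
    case (elim y)
    have "\<i> * inverse (\<i> * complex_of_real y * cauchy_G \<mu> (\<i> * complex_of_real y))
        = cauchy_F \<mu> (\<i> * complex_of_real y) / complex_of_real y"
      using elim by (simp add: cauchy_F_def field_simps)
    then show ?case by (simp only: Im_divide_of_real)
  qed
  ultimately show ?thesis by (simp add: tendsto_cong)
qed

lemma cauchy_F_at_top:
  assumes \<mu>: "real_prob \<mu>"
  shows "LIM y at_top. Im (cauchy_F \<mu> (\<i> * complex_of_real y)) :> at_top"
proof -
  have "LIM y at_top. (Im (cauchy_F \<mu> (\<i> * complex_of_real y)) / y) * y :> at_top"
    by (rule filterlim_tendsto_pos_mult_at_top[OF cauchy_F_asymptotics[OF \<mu>]]) (auto intro: filterlim_ident)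
  moreover have "\<forall>\<^sub>F y in at_top. (Im (cauchy_F \<mu> (\<i> * complex_of_real y)) / y) * y = Im (cauchy_F \<mu> (\<i> * complex_of_real y))"
    using eventually_gt_at_top[of 0] by eventually_elim simp
  ultimately show ?thesis by (simp add: filterlim_cong)
qed

lemma real_prob_translate:
  assumes "real_prob \<mu>"
  shows "real_prob (translate \<mu> a)"
  using assms
  by (auto simp: translate_def real_prob_def intro!: prob_space.prob_space_distr
        real_prob_measurable[OF assms])

lemma cauchy_G_translate:
  assumes "real_prob \<mu>"
  shows "cauchy_G (translate \<mu> a) z = cauchy_G \<mu> (z - of_real a)"
proof -
  have "(\<lambda>x. x + a) \<in> borel_measurable \<mu>"
    by (rule real_prob_measurable[OF assms]) measurable
  then show ?thesis
    unfolding cauchy_G_def translate_def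
    by (subst integral_distr) (auto simp: algebra_simps)
qed

section \<open>The Cayley transform and uniqueness on the line\<close>

definition cayley_real :: "real \<Rightarrow> complex" where
  "cayley_real x = (of_real x + \<i>) / (of_real x - \<i>)"

lemma norm_cayley_real: "norm (cayley_real x) = 1"
proof -
  have "of_real x - \<i> = cnj (of_real x + \<i>)" by simp
  then have "norm (of_real x - \<i>) = norm (of_real x + \<i>)" by (metis complex_mod_cnj)
  moreover have "of_real x + \<i> \<noteq> 0" by (simp add: complex_eq_iff)
  ultimately show ?thesis by (simp add: cayley_real_def norm_divide)
qed

lemma cayley_real_inverse: "Re (\<i> * (cayley_real x + 1) / (cayley_real x - 1)) = x"
proof -
  have nz: "of_real x - \<i> \<noteq> 0" by (simp add: complex_eq_iff)
  then have "cayley_real x + 1 = 2 * of_real x / (of_real x - \<i>)"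
      "cayley_real x - 1 = 2 * \<i> / (of_real x - \<i>)"
    by (simp_all add: cayley_real_def field_simps)
  then have "\<i> * (cayley_real x + 1) / (cayley_real x - 1) = of_real x"
    using nz by simp
  then show ?thesis by simp
qed

text \<open>As a function of x, the integrand of \<psi> is fractional linear with its pole at x = z,
  hence a constant plus a multiple of the resolvent at z. The map from w to z takes the disc into
  the upper half-plane, so \<psi> on the disc is expressed by G.\<close>

lemma psi_T_cayley_real:
  assumes \<mu>: "real_prob \<mu>" and w: "norm w < 1"
  defines "z \<equiv> \<i> * (1 + w) / (1 - w)"
  shows "psi_T (distr \<mu> borel cayley_real) w = (1 - (z - \<i>) * cauchy_G \<mu> z) / (1 - w) - 1"
    and "Im z > 0"
proof -
  interpret prob_space \<mu> using \<mu> by (rule real_prob_imp_prob_space)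
  have w1: "1 - w \<noteq> 0" using w by auto
  have "z = \<i> * ((1 + w) / (1 - w))" by (simp add: z_def)
  then have "Im z = Re ((1 + w) / (1 - w))" by (simp only: Im_i_times)
  also have "\<dots> = (1 - (norm w)\<^sup>2) / (norm (1 - w))\<^sup>2"
    unfolding Re_divide cmod_power2 by (simp add: algebra_simps power2_eq_square)
  also have "\<dots> > 0" using w w1 by (intro divide_pos_pos) (auto simp: power_less_one_iff abs_square_less_1)
  finally show z: "Im z > 0" .
  have meas: "cayley_real \<in> borel_measurable \<mu>"
    unfolding cayley_real_def by (rule real_prob_measurable[OF \<mu>]) measurable
  have "psi_T (distr \<mu> borel cayley_real) w = (\<integral>x. w * cayley_real x / (1 - w * cayley_real x) \<partial>\<mu>)"
    unfolding psi_T_def by (rule integral_distr[OF meas]) measurable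
  also have "\<dots> = (\<integral>x. (1 / (1 - w) - 1) - (z - \<i>) / (1 - w) * (1 / (z - complex_of_real x)) \<partial>\<mu>)"
  proof (rule Bochner_Integration.integral_cong[OF refl])
    fix x
    have nz: "of_real x - \<i> \<noteq> 0" by (simp add: complex_eq_iff)
    have zx: "z - of_real x \<noteq> 0" using z by (auto simp: complex_eq_iff)
    have "(1 - w) * z = \<i> * (1 + w)" using w1 by (simp add: z_def)
    then have zw: "(1 - w) * (of_real x - z) = (of_real x - \<i>) - w * (of_real x + \<i>)"
      by (simp add: algebra_simps)
    have "1 - w * cayley_real x = (1 - w) * (of_real x - z) / (of_real x - \<i>)"
      unfolding zw using nz by (simp add: cayley_real_def field_simps)
    moreover have "1 - w * cayley_real x \<noteq> 0"
      using norm_one_minus_mult_ge[OF norm_cayley_real, of w x] w by auto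
    then have "w * cayley_real x / (1 - w * cayley_real x) = 1 / (1 - w * cayley_real x) - 1"
      by (simp add: field_simps)
    ultimately have "w * cayley_real x / (1 - w * cayley_real x)
        = (of_real x - \<i>) / ((1 - w) * (of_real x - z)) - 1" by simp
    also have "(of_real x - \<i>) / ((1 - w) * (of_real x - z)) = 1 / (1 - w) - (z - \<i>) / (1 - w) * (1 / (z - of_real x))"
    proof -
      have "(of_real x - \<i>) / ((1 - w) * (of_real x - z)) =
          ((of_real x - z) + (z - \<i>)) / ((1 - w) * (of_real x - z))" by simp
      also have "\<dots> = 1 / (1 - w) + (z - \<i>) / (1 - w) * (1 / (of_real x - z))"
        unfolding add_divide_distrib using zx by simp
      also have "1 / (of_real x - z) = - (1 / (z - of_real x))"
        by (metis minus_diff_eq minus_divide_right)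
      finally show ?thesis by simp
    qed
    finally show "w * cayley_real x / (1 - w * cayley_real x)
        = (1 / (1 - w) - 1) - (z - \<i>) / (1 - w) * (1 / (z - complex_of_real x))" by simp
  qed
  also have "\<dots> = (1 / (1 - w) - 1) - (z - \<i>) / (1 - w) * cauchy_G \<mu> z"
    unfolding cauchy_G_def
    by (subst Bochner_Integration.integral_diff)
       (simp_all only: integrable_const integrable_mult_right integrable_resolvent[OF \<mu> z]
          integral_mult_right_zero lebesgue_integral_const prob_space scaleR_one)
  also have "\<dots> = (1 - (z - \<i>) * cauchy_G \<mu> z) / (1 - w) - 1"
    by (simp add: diff_divide_distrib left_diff_distrib)
  finally show "psi_T (distr \<mu> borel cayley_real) w = (1 - (z - \<i>) * cauchy_G \<mu> z) / (1 - w) - 1" .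
qed

lemma real_prob_eqI_cauchy_G:
  assumes \<mu>: "real_prob \<mu>" and \<mu>': "real_prob \<mu>'"
    and G: "\<And>z. Im z > 0 \<Longrightarrow> cauchy_G \<mu> z = cauchy_G \<mu>' z"
  shows "\<mu> = \<mu>'"
proof -
  have meas: "cayley_real \<in> borel_measurable borel"
    unfolding cayley_real_def by measurable
  have eq: "distr \<mu> borel cayley_real = distr \<mu>' borel cayley_real"
  proof (rule circle_prob_eqI_psi_T)
    show "circle_prob (distr \<mu> borel cayley_real)" "circle_prob (distr \<mu>' borel cayley_real)"
      by (rule circle_prob_distr[OF _ meas norm_cayley_real], fact)+
  qed (use \<mu> \<mu>' in \<open>simp add: psi_T_cayley_real G\<close>)
  \<comment> \<open>The Cayley transform has a measurable left inverse, so no information is lost on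
    the circle. At \<zeta> = 1 the quotient is 0 by convention, which is harmless because
    \<open>cayley_real\<close> never takes the value 1.\<close>
  have inverse: "distr (distr \<rho> borel cayley_real) borel (\<lambda>\<zeta>. Re (\<i> * (\<zeta> + 1) / (\<zeta> - 1))) = \<rho>"
    if "real_prob \<rho>" for \<rho>
  proof -
    have "distr (distr \<rho> borel cayley_real) borel (\<lambda>\<zeta>. Re (\<i> * (\<zeta> + 1) / (\<zeta> - 1)))
        = distr \<rho> borel ((\<lambda>\<zeta>. Re (\<i> * (\<zeta> + 1) / (\<zeta> - 1))) \<circ> cayley_real)"
      by (rule distr_distr) (use real_prob_measurable[OF that meas] in auto)
    also have "\<dots> = \<rho>"
      using real_prob_sets[OF that] by (simp add: o_def cayley_real_inverse distr_id2)
    finally show ?thesis .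
  qed
  show ?thesis using inverse[OF \<mu>] inverse[OF \<mu>'] unfolding eq by (rule trans[OF sym])
qed

section \<open>The wrapping formula\<close>

lemma class_L_real_prob: "\<mu> \<in> class_L \<Longrightarrow> real_prob \<mu>"
  by (simp add: class_L_def)

lemma cauchy_F_add_int_multiple:
  assumes \<mu>: "\<mu> \<in> class_L" and z: "Im z > 0"
  shows "cauchy_F \<mu> (z + 2 * of_real pi * of_int k) = cauchy_F \<mu> z + 2 * of_real pi * of_int k"
proof -
  have nat: "cauchy_F \<mu> (w + 2 * of_real pi * of_nat n) = cauchy_F \<mu> w + 2 * of_real pi * of_nat n"
    if w: "Im w > 0" for w n
  proof (induction n)
    case (Suc n)
    have "cauchy_F \<mu> (w + 2 * of_real pi * of_nat (Suc n))
        = cauchy_F \<mu> ((w + 2 * of_real pi * of_nat n) + 2 * of_real pi)"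
      by (simp add: algebra_simps)
    also have "\<dots> = cauchy_F \<mu> (w + 2 * of_real pi * of_nat n) + 2 * of_real pi"
      using \<mu> w unfolding class_L_def by simp
    also have "\<dots> = cauchy_F \<mu> w + 2 * of_real pi * of_nat (Suc n)"
      unfolding Suc by (simp add: algebra_simps)
    finally show ?case .
  qed simp
  show ?thesis
  proof (cases "k \<ge> 0")
    case True
    then show ?thesis using nat[OF z, of "nat k"] by simp
  next
    case False
    \<comment> \<open>For negative \<open>k\<close> the shifted point serves as the base point; the
      shift is real, so it stays in the upper half-plane.\<close>
    define w where "w = z + 2 * of_real pi * of_int k"
    have "Im w > 0" using z by (simp add: w_def)
    from nat[OF this, of "nat (- k)"] show ?thesis
      using False by (simp add: w_def)
  qed
qed

text \<open>Quasi-periodicity of F enters the wrapping formula here: it makes the identity exact for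
  every truncation, so that only the limit in \<open>m\<close> remains to be exchanged with the
  integral.\<close>

lemma integral_pole_sum:
  assumes \<mu>: "\<mu> \<in> class_L" and z: "Im z > 0"
  shows "(\<integral>x. pole_sum m (z - of_real x) \<partial>\<mu>) = pole_sum m (cauchy_F \<mu> z)"
    and "integrable \<mu> (\<lambda>x. pole_sum m (z - of_real x))"
proof -
  let ?z = "\<lambda>k. z + 2 * of_real pi * of_int k"
  note rp = class_L_real_prob[OF \<mu>]
  have z': "Im (?z k) > 0" for k using z by simp
  have eq: "pole_sum m (z - of_real x) = (\<Sum>k\<in>{- int m..<int m}. 2 * \<i> * (1 / (?z k - of_real x)))" for x
    unfolding pole_sum_def by (intro sum.cong refl) (simp add: algebra_simps)
  show "integrable \<mu> (\<lambda>x. pole_sum m (z - of_real x))"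
    unfolding eq by (intro Bochner_Integration.integrable_sum integrable_mult_right integrable_resolvent rp z')
  have "(\<integral>x. pole_sum m (z - of_real x) \<partial>\<mu>) = (\<Sum>k\<in>{- int m..<int m}. 2 * \<i> * cauchy_G \<mu> (?z k))"
    unfolding eq cauchy_G_def
    by (subst Bochner_Integration.integral_sum)
       (intro integrable_mult_right integrable_resolvent rp z', simp only: integral_mult_right_zero)
  also have "\<dots> = pole_sum m (cauchy_F \<mu> z)"
    unfolding pole_sum_def
  proof (intro sum.cong refl)
    fix k
    have "cauchy_G \<mu> (?z k) = 1 / cauchy_F \<mu> (?z k)" by (simp add: cauchy_F_def)
    then show "2 * \<i> * cauchy_G \<mu> (?z k) = 2 * \<i> / (cauchy_F \<mu> z + 2 * of_real pi * of_int k)"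
      unfolding cauchy_F_add_int_multiple[OF \<mu> z] by simp
  qed
  finally show "(\<integral>x. pole_sum m (z - of_real x) \<partial>\<mu>) = pole_sum m (cauchy_F \<mu> z)" .
qed

lemma half_cot_bound:
  assumes "Im u > 0"
  shows "norm (half_cot u) \<le> 1 + 2 * exp (- Im u) / (1 - exp (- Im u))"
  using norm_half_cot_minus_one[OF assms] norm_triangle_ineq2[of "half_cot u" 1] by simp

lemma exp_i_neq_one: "Im u > 0 \<Longrightarrow> exp (\<i> * u) \<noteq> 1"
  using norm_exp_i_less_one[of u] by (metis norm_one less_irrefl)

lemma borel_measurable_half_cot:
  assumes "Im z > 0"
  shows "(\<lambda>x. half_cot (z - complex_of_real x)) \<in> borel_measurable borel"
  unfolding half_cot_def
  by (intro borel_measurable_continuous_onI continuous_intros)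
     (use exp_i_neq_one[of "z - complex_of_real _"] assms in auto)

lemma integrable_half_cot:
  assumes "real_prob \<mu>" and z: "Im z > 0"
  shows "integrable \<mu> (\<lambda>x. half_cot (z - of_real x))"
proof (rule real_prob_integrable[OF assms(1) borel_measurable_half_cot[OF z]])
  show "norm (half_cot (z - of_real x)) \<le> 1 + 2 * exp (- Im z) / (1 - exp (- Im z))" for x
    using half_cot_bound[of "z - of_real x"] z by simp
qed

text \<open>The partial sums of the partial fraction expansion are not bounded on horizontal lines, but
  differences of them are; this is why the interchange of limit and integral is carried out for two
  points at once.\<close>

lemma integral_half_cot_diff:
  assumes \<mu>: "\<mu> \<in> class_L" and z: "Im z > 0" and w: "Im w > 0"
  shows "(\<integral>x. half_cot (z - of_real x) \<partial>\<mu>) - (\<integral>x. half_cot (w - of_real x) \<partial>\<mu>)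
    = half_cot (cauchy_F \<mu> z) - half_cot (cauchy_F \<mu> w)"
proof -
  note rp = class_L_real_prob[OF \<mu>]
  interpret prob_space \<mu> using rp by (rule real_prob_imp_prob_space)
  let ?h = "\<lambda>u. 1 + 2 * exp (- Im u) / (1 - exp (- Im u))"
  \<comment> \<open>Subtracting the same real x from z and w changes neither their imaginary parts
    nor z - w, so \<open>pole_sum_diff_bound\<close> yields one constant for all x and
    \<open>m\<close>.\<close>
  let ?B = "norm (z - w) * (?h z / (2 * Im z) + ?h w / (2 * Im w))"
  have bnd: "norm (pole_sum m (z - of_real x) - pole_sum m (w - of_real x)) \<le> ?B" for m x
  proof -
    have Re_le: "Re (half_cot (u - of_real x)) / (2 * Im u) \<le> ?h u / (2 * Im u)" if "Im u > 0" for u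
      using half_cot_bound[of "u - of_real x"] complex_Re_le_cmod[of "half_cot (u - of_real x)"] that
      by (intro divide_right_mono) auto
    have "norm (pole_sum m (z - of_real x) - pole_sum m (w - of_real x))
      \<le> norm (z - w) * (Re (half_cot (z - of_real x)) / (2 * Im z) + Re (half_cot (w - of_real x)) / (2 * Im w))"
      using pole_sum_diff_bound[of "z - of_real x" "w - of_real x" m] z w by simp
    also have "\<dots> \<le> ?B"
      by (intro mult_left_mono add_mono Re_le z w) auto
    finally show ?thesis .
  qed
  have "(\<lambda>m. \<integral>x. pole_sum m (z - of_real x) - pole_sum m (w - of_real x) \<partial>\<mu>)
      \<longlonglongrightarrow> (\<integral>x. half_cot (z - of_real x) - half_cot (w - of_real x) \<partial>\<mu>)"
  proof (rule integral_dominated_convergence[where w = "\<lambda>_. ?B"])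
    show "(\<lambda>x. half_cot (z - of_real x) - half_cot (w - of_real x)) \<in> borel_measurable \<mu>"
      using integrable_half_cot[OF rp z] integrable_half_cot[OF rp w] by measurable
    show "(\<lambda>x. pole_sum m (z - of_real x) - pole_sum m (w - of_real x)) \<in> borel_measurable \<mu>" for m
      using integral_pole_sum(2)[OF \<mu> z, of m] integral_pole_sum(2)[OF \<mu> w, of m] by measurable
    show "AE x in \<mu>. (\<lambda>m. pole_sum m (z - of_real x) - pole_sum m (w - of_real x))
        \<longlonglongrightarrow> half_cot (z - of_real x) - half_cot (w - of_real x)"
      by (intro always_eventually allI tendsto_diff pole_sum_tendsto) (use z w in auto)
    show "AE x in \<mu>. norm (pole_sum m (z - of_real x) - pole_sum m (w - of_real x)) \<le> ?B" for m
      using bnd by simp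
  qed simp
  moreover have "(\<lambda>m. \<integral>x. pole_sum m (z - of_real x) - pole_sum m (w - of_real x) \<partial>\<mu>)
      \<longlonglongrightarrow> half_cot (cauchy_F \<mu> z) - half_cot (cauchy_F \<mu> w)"
    unfolding Bochner_Integration.integral_diff[OF integral_pole_sum(2)[OF \<mu> z] integral_pole_sum(2)[OF \<mu> w]]
      integral_pole_sum(1)[OF \<mu> z] integral_pole_sum(1)[OF \<mu> w]
    by (intro tendsto_diff pole_sum_tendsto Im_cauchy_F_pos rp z w)
  ultimately have "(\<integral>x. half_cot (z - of_real x) - half_cot (w - of_real x) \<partial>\<mu>)
      = half_cot (cauchy_F \<mu> z) - half_cot (cauchy_F \<mu> w)" by (rule LIMSEQ_unique)
  then show ?thesis
    using integrable_half_cot[OF rp z] integrable_half_cot[OF rp w]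
    by (simp add: Bochner_Integration.integral_diff)
qed

lemma half_cot_tendsto_1:
  assumes "filterlim (\<lambda>t. Im (u t)) at_top F"
  shows "((\<lambda>t. half_cot (u t)) \<longlongrightarrow> 1) F"
proof -
  have e: "((\<lambda>t. exp (- Im (u t))) \<longlongrightarrow> 0) F"
    by (rule filterlim_compose[OF exp_at_bot])
       (use assms in \<open>simp add: filterlim_uminus_at_bot\<close>)
  have "((\<lambda>t. 2 * exp (- Im (u t)) / (1 - exp (- Im (u t)))) \<longlongrightarrow> 2 * 0 / (1 - 0)) F"
    by (intro tendsto_intros e) auto
  then have "((\<lambda>t. 2 * exp (- Im (u t)) / (1 - exp (- Im (u t)))) \<longlongrightarrow> 0) F" by simp
  moreover have "\<forall>\<^sub>F t in F. norm (half_cot (u t) - 1) \<le> 2 * exp (- Im (u t)) / (1 - exp (- Im (u t)))"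
    using filterlim_at_top_dense[THEN iffD1, OF assms, rule_format, of 0]
    by eventually_elim (rule norm_half_cot_minus_one)
  ultimately have "((\<lambda>t. half_cot (u t) - 1) \<longlongrightarrow> 0) F"
    by (rule Lim_null_comparison[rotated])
  then show ?thesis by (rule LIM_zero_cancel)
qed

text \<open>The identity for differences leaves an additive constant open. It is fixed by letting w
  = i y go to infinity: both terms in w tend to 1, the integral by dominated convergence and the
  other because Im (F (i y)) tends to infinity.\<close>

lemma integral_half_cot:
  assumes \<mu>: "\<mu> \<in> class_L" and z: "Im z > 0"
  shows "(\<integral>x. half_cot (z - of_real x) \<partial>\<mu>) = half_cot (cauchy_F \<mu> z)"
proof -
  note rp = class_L_real_prob[OF \<mu>]
  interpret prob_space \<mu> using rp by (rule real_prob_imp_prob_space)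
  let ?w = "\<lambda>y. \<i> * complex_of_real y"
  \<comment> \<open>The bound of \<open>half_cot\<close> at height 1. It decreases with the height
    and so serves for all y \<ge> 1.\<close>
  let ?B = "1 + 2 * exp (- 1) / (1 - exp (- 1)) :: real"
  have 1: "((\<lambda>y. \<integral>x. half_cot (?w y - of_real x) \<partial>\<mu>) \<longlongrightarrow> (\<integral>x. 1 \<partial>\<mu>)) at_top"
  proof (rule integral_dominated_convergence_at_top[where w = "\<lambda>_. ?B"])
    show "AE x in \<mu>. ((\<lambda>y. half_cot (?w y - of_real x)) \<longlongrightarrow> 1) at_top"
      by (intro always_eventually allI half_cot_tendsto_1) (simp add: filterlim_ident)
    show "\<forall>\<^sub>F y in at_top. AE x in \<mu>. norm (half_cot (?w y - of_real x)) \<le> ?B"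
      using eventually_ge_at_top[of 1]
    proof eventually_elim
      case (elim y)
      have "norm (half_cot (?w y - of_real x)) \<le> ?B" for x
      proof -
        have "norm (half_cot (?w y - of_real x)) \<le> 1 + 2 * exp (- y) / (1 - exp (- y))"
          using half_cot_bound[of "?w y - of_real x"] elim by simp
        also have "\<dots> \<le> ?B"
          using elim by (intro add_left_mono frac_le mult_left_mono) auto
        finally show ?thesis .
      qed
      then show ?case by simp
    qed
    show "(\<lambda>x. half_cot (?w y - of_real x)) \<in> borel_measurable \<mu>" for y
      unfolding half_cot_def by (rule real_prob_measurable[OF rp]) measurable
  qed auto
  have "((\<lambda>y. (\<integral>x. half_cot (z - of_real x) \<partial>\<mu>) - (\<integral>x. half_cot (?w y - of_real x) \<partial>\<mu>))
      \<longlongrightarrow> (\<integral>x. half_cot (z - of_real x) \<partial>\<mu>) - 1) at_top"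
    using 1 by (intro tendsto_intros) (simp add: prob_space)
  moreover have "\<forall>\<^sub>F y in at_top. (\<integral>x. half_cot (z - of_real x) \<partial>\<mu>) - (\<integral>x. half_cot (?w y - of_real x) \<partial>\<mu>)
      = half_cot (cauchy_F \<mu> z) - half_cot (cauchy_F \<mu> (?w y))"
    using eventually_gt_at_top[of 0]
    by eventually_elim (rule integral_half_cot_diff[OF \<mu> z], simp)
  ultimately have "((\<lambda>y. half_cot (cauchy_F \<mu> z) - half_cot (cauchy_F \<mu> (?w y)))
      \<longlongrightarrow> (\<integral>x. half_cot (z - of_real x) \<partial>\<mu>) - 1) at_top"
    by (rule Lim_transform_eventually)
  moreover have "((\<lambda>y. half_cot (cauchy_F \<mu> z) - half_cot (cauchy_F \<mu> (?w y)))
      \<longlongrightarrow> half_cot (cauchy_F \<mu> z) - 1) at_top"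
    by (intro tendsto_intros half_cot_tendsto_1 cauchy_F_at_top rp)
  ultimately have "(\<integral>x. half_cot (z - of_real x) \<partial>\<mu>) - 1 = half_cot (cauchy_F \<mu> z) - 1"
    by (rule tendsto_unique[OF trivial_limit_at_top_linorder])
  then show ?thesis by simp
qed

section \<open>From the cotangent identity to the transform of the wrapped measure\<close>

lemma circle_prob_wrap: "real_prob \<mu> \<Longrightarrow> circle_prob (wrap \<mu>)"
  unfolding wrap_def by (rule circle_prob_distr) (auto intro!: borel_measurable_continuous_onI continuous_intros)

lemma borel_measurable_cis_uminus: "(\<lambda>x. cis (- x)) \<in> borel_measurable borel"
  by (auto intro!: borel_measurable_continuous_onI continuous_intros)

text \<open>The sign in x -> exp (- i x) is what makes exp (i z) times the circle variable equal to
  exp (i (z - x)), the argument of the Cauchy kernel.\<close>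

lemma psi_T_wrap:
  assumes \<mu>: "real_prob \<mu>" and z: "Im z > 0"
  shows "1 + 2 * psi_T (wrap \<mu>) (exp (\<i> * z)) = (\<integral>x. half_cot (z - of_real x) \<partial>\<mu>)"
proof -
  interpret prob_space \<mu> using \<mu> by (rule real_prob_imp_prob_space)
  let ?e = "\<lambda>x. exp (\<i> * (z - of_real x))"
  let ?p = "\<lambda>x. exp (\<i> * z) * cis (- x) / (1 - exp (\<i> * z) * cis (- x))"
  have p: "1 + 2 * ?p x = half_cot (z - of_real x)" for x
  proof -
    have "exp (\<i> * z) * cis (- x) = ?e x" by (simp add: cis_conv_exp right_diff_distrib flip: exp_add)
    moreover have "1 - ?e x \<noteq> 0" using exp_i_neq_one[of "z - of_real x"] z by simp
    ultimately show ?thesis by (simp add: half_cot_def field_simps)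
  qed
  have psi: "psi_T (wrap \<mu>) (exp (\<i> * z)) = (\<integral>x. ?p x \<partial>\<mu>)"
    unfolding psi_T_def wrap_def
    by (rule integral_distr[OF real_prob_measurable[OF \<mu> borel_measurable_cis_uminus]]) measurable
  have halve: "a = ((1 + 2 * a) - 1) / 2" for a :: complex by simp
  have p': "?p x = (half_cot (z - of_real x) - 1) / 2" for x
    unfolding p[symmetric] by (rule halve)
  have "integrable \<mu> ?p"
    unfolding p' using integrable_half_cot[OF \<mu> z]
    by (intro integrable_divide_zero Bochner_Integration.integrable_diff) auto
  then have "1 + 2 * (\<integral>x. ?p x \<partial>\<mu>) = (\<integral>x. 1 + 2 * ?p x \<partial>\<mu>)"
    by (subst Bochner_Integration.integral_add)
       (simp_all only: integrable_const integrable_mult_right integral_mult_right_zero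
          lebesgue_integral_const prob_space scaleR_one)
  then show ?thesis unfolding psi p .
qed

text \<open>Equal values of 1 + 2 \<psi> and (1 + E) / (1 - E) mean \<psi> / (1 + \<psi>) = E, since
  w -> (1 + w) / (1 - w) is injective.\<close>

lemma eta_T_wrap:
  assumes \<mu>: "\<mu> \<in> class_L" and z: "Im z > 0"
  shows "eta_T (wrap \<mu>) (exp (\<i> * z)) = exp (\<i> * cauchy_F \<mu> z)"
proof -
  let ?E = "exp (\<i> * cauchy_F \<mu> z)"
  let ?psi = "psi_T (wrap \<mu>) (exp (\<i> * z))"
  have "1 - ?E \<noteq> 0"
    using exp_i_neq_one[OF Im_cauchy_F_pos[OF class_L_real_prob[OF \<mu>] z]] by simp
  moreover have "1 + 2 * ?psi = (1 + ?E) / (1 - ?E)"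
    unfolding psi_T_wrap[OF class_L_real_prob[OF \<mu>] z] integral_half_cot[OF \<mu> z] by (rule half_cot_def)
  ultimately have "(1 + 2 * ?psi) * (1 - ?E) = 1 + ?E" by simp
  then have "2 * (?psi * (1 - ?E)) = 2 * ?E" by algebra
  then have "?psi * (1 - ?E) = ?E" by simp
  then have "?psi = ?E / (1 - ?E)" "1 + ?psi = 1 / (1 - ?E)"
    using \<open>1 - ?E \<noteq> 0\<close> by (simp_all add: eq_divide_eq distrib_right del: right_minus_eq)
  then show ?thesis using \<open>1 - ?E \<noteq> 0\<close> unfolding eta_T_def by simp
qed

section \<open>Herglotz representation\<close>

definition disc_to_half_plane :: "complex \<Rightarrow> complex" where
  "disc_to_half_plane w = \<i> * (1 + w) / (1 - w)"

text \<open>This is - cot (\<pi> t), so a uniform t gives the standard Cauchy law, the harmonic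
  measure of the half-plane seen from i. The real part discards only a zero imaginary part, and t =
  0 and t = 1, which correspond to infinity, receive the value 0.\<close>

definition circle_to_line :: "real \<Rightarrow> real" where
  "circle_to_line t = Re (disc_to_half_plane (cis (2 * pi * t)))"

abbreviation unit_interval :: "real measure" where
  "unit_interval \<equiv> restrict_space lborel {0..1}"

lemma Im_disc_to_half_plane:
  "Im (disc_to_half_plane w) = (1 - (norm w)\<^sup>2) / (norm (1 - w))\<^sup>2"
proof -
  have "disc_to_half_plane w = \<i> * ((1 + w) / (1 - w))" by (simp add: disc_to_half_plane_def)
  then have "Im (disc_to_half_plane w) = Re ((1 + w) / (1 - w))" by (simp only: Im_i_times)
  also have "\<dots> = (1 - (norm w)\<^sup>2) / (norm (1 - w))\<^sup>2"
    unfolding Re_divide cmod_power2 by (simp add: algebra_simps power2_eq_square)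
  finally show ?thesis .
qed

lemma Im_disc_to_half_plane_pos:
  assumes "norm w < 1"
  shows "Im (disc_to_half_plane w) > 0"
proof -
  have "1 - w \<noteq> 0" using assms by auto
  then show ?thesis
    unfolding Im_disc_to_half_plane using assms
    by (intro divide_pos_pos) (auto simp: power_less_one_iff abs_square_less_1)
qed

lemma disc_to_half_plane_cis: "disc_to_half_plane (cis (2 * pi * t)) = of_real (circle_to_line t)"
  by (simp add: complex_eq_iff circle_to_line_def Im_disc_to_half_plane)

lemma borel_measurable_circle_to_line [measurable]: "circle_to_line \<in> borel_measurable borel"
proof -
  have [measurable]: "(\<lambda>t. cis (2 * pi * t)) \<in> borel_measurable borel"
    by (intro borel_measurable_continuous_onI continuous_intros)
  show ?thesis unfolding circle_to_line_def disc_to_half_plane_def by measurable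
qed

lemma prob_space_unit_interval: "prob_space unit_interval"
  by (auto simp add: emeasure_restrict_space space_restrict_space intro!: prob_spaceI)

lemma unit_interval_measurable: "f \<in> borel_measurable borel \<Longrightarrow> f \<in> borel_measurable unit_interval"
  by (simp add: measurable_restrict_space1)

lemma unit_interval_mean_value:
  assumes f: "f holomorphic_on ball 0 1" and r: "0 < r" "r < 1"
  shows "(\<integral>t. f (of_real r * cis (2 * pi * t)) \<partial>unit_interval) = f 0"
proof -
  let ?g = "\<lambda>t. f (of_real r * cis (2 * pi * t))"
  have sub: "cball 0 r \<subseteq> ball (0::complex) 1" using r by auto
  have "((\<lambda>u. f u / (u - 0)) has_contour_integral 2 * of_real pi * \<i> * f 0) (circlepath 0 r)"
    by (rule Cauchy_integral_circlepath_simple) (use r holomorphic_on_subset[OF f sub] in auto)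
  then have "((\<lambda>t. f (circlepath 0 r t) / (circlepath 0 r t - 0) *
      vector_derivative (circlepath 0 r) (at t within {0..1})) has_integral 2 * of_real pi * \<i> * f 0) {0..1}"
    unfolding has_contour_integral_def .
  then have "((\<lambda>t. 2 * of_real pi * \<i> * ?g t) has_integral 2 * of_real pi * \<i> * f 0) {0..1}"
  proof (rule has_integral_eq[rotated])
    fix t :: real assume "t \<in> {0..1}"
    then have "vector_derivative (circlepath 0 r) (at t within {0..1})
        = 2 * of_real pi * \<i> * of_real r * exp (2 * of_real pi * \<i> * of_real t)"
      by (subst vector_derivative_circlepath01) (auto simp: mult_ac)
    moreover have "circlepath 0 r t = of_real r * cis (2 * pi * t)"
      by (simp add: circlepath cis_conv_exp mult_ac)
    moreover have "exp (2 * of_real pi * \<i> * of_real t) = cis (2 * pi * t)"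
      by (simp add: cis_conv_exp mult_ac)
    ultimately show "f (circlepath 0 r t) / (circlepath 0 r t - 0) *
        vector_derivative (circlepath 0 r) (at t within {0..1}) = 2 * of_real pi * \<i> * ?g t"
      using r by simp
  qed
  from has_integral_mult_right[OF this, of "1 / (2 * of_real pi * \<i>)"]
  have "(?g has_integral f 0) {0..1}" by simp
  then have "integral {0..1} ?g = f 0" by (rule integral_unique)
  moreover have "continuous_on {0..1} ?g"
    by (rule continuous_on_compose2[OF holomorphic_on_imp_continuous_on[OF f]])
       (use r in \<open>auto intro!: continuous_intros simp: norm_mult\<close>)
  then have "set_integrable lborel {0..1} ?g"
    by (rule borel_integrable_atLeastAtMost')
  then have "(LINT t:{0..1}|lborel. ?g t) = integral {0..1} ?g"
    by (rule set_borel_integral_eq_integral(2))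
  ultimately show ?thesis
    by (simp add: integral_restrict_space set_lebesgue_integral_def)
qed

lemma boundary_integrable:
  assumes p: "p holomorphic_on {z. Im z > - \<delta>}" and \<delta>: "\<delta> > 0"
    and B: "\<And>z. Im z \<ge> 0 \<Longrightarrow> norm (p z) \<le> B"
  shows "integrable unit_interval (\<lambda>t. p (of_real (circle_to_line t)))"
proof -
  interpret prob_space unit_interval by (rule prob_space_unit_interval)
  have "(\<lambda>x. p (complex_of_real x)) \<in> borel_measurable borel"
    by (intro borel_measurable_continuous_onI continuous_on_compose2[OF holomorphic_on_imp_continuous_on[OF p]])
       (use \<delta> in \<open>auto intro!: continuous_intros\<close>)
  then have "(\<lambda>t. p (complex_of_real (circle_to_line t))) \<in> borel_measurable borel"
    by (rule measurable_compose[OF borel_measurable_circle_to_line])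
  then show ?thesis
    by (intro integrable_const_bound[where B = B] unit_interval_measurable) (use B in auto)
qed

text \<open>Poisson's formula at i. The mean value property on circles of radius r < 1 passes to the
  boundary as r -> 1, because p is bounded and continuous up to the line; the point at infinity is a
  null set.\<close>

lemma boundary_mean_value:
  assumes p: "p holomorphic_on {z. Im z > - \<delta>}" and \<delta>: "\<delta> > 0"
    and B: "\<And>z. Im z \<ge> 0 \<Longrightarrow> norm (p z) \<le> B"
  shows "(\<integral>t. p (of_real (circle_to_line t)) \<partial>unit_interval) = p \<i>"
proof -
  interpret prob_space unit_interval by (rule prob_space_unit_interval)
  define f where "f w = p (disc_to_half_plane w)" for w
  \<comment> \<open>The offset 2 keeps \<open>r n\<close> strictly between 0 and 1 also for n =
    0.\<close>
  define r where "r n = 1 - 1 / real (n + 2)" for n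
  have r: "0 < r n" "r n < 1" for n by (auto simp: r_def)
  have rlim: "r \<longlonglongrightarrow> 1"
  proof -
    have "(\<lambda>n. 1 - 1 / real (n + 2)) \<longlonglongrightarrow> 1 - 0"
      by (intro tendsto_intros LIMSEQ_ignore_initial_segment[OF lim_inverse_n'])
    then show ?thesis by (simp add: r_def[abs_def])
  qed
  have open_hp: "open {z. Im z > - \<delta>}" by (rule open_halfspace_Im_gt)
  have "f holomorphic_on ball 0 1"
    unfolding f_def disc_to_half_plane_def
    by (rule holomorphic_on_compose_gen[OF _ p, unfolded o_def])
       (use Im_disc_to_half_plane_pos \<delta> in \<open>fastforce intro!: holomorphic_intros simp: disc_to_half_plane_def\<close>)+
  then have mv: "(\<integral>t. f (of_real (r n) * cis (2 * pi * t)) \<partial>unit_interval) = f 0" for n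
    by (rule unit_interval_mean_value) (fact r)+
  have f0: "f 0 = p \<i>" by (simp add: f_def disc_to_half_plane_def)
  have bnd: "norm (f (of_real (r n) * cis (2 * pi * t))) \<le> B" for n t
    unfolding f_def
    by (intro B less_imp_le Im_disc_to_half_plane_pos) (use r[of n] in \<open>simp add: norm_mult\<close>)
  have lim: "(\<lambda>n. f (of_real (r n) * cis (2 * pi * t))) \<longlonglongrightarrow> p (of_real (circle_to_line t))"
    if t: "0 < t" "t < 1" for t
  proof -
    have c1: "cis (2 * pi * t) \<noteq> 1"
    proof
      assume "cis (2 * pi * t) = 1"
      then have "cos (2 * pi * t) = 1" by (simp add: complex_eq_iff)
      then obtain k :: int where "2 * pi * t = of_int k * 2 * pi" unfolding cos_one_2pi_int by blast
      then have "t = of_int k" by simp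
      with t show False by simp
    qed
    have "(\<lambda>n. disc_to_half_plane (of_real (r n) * cis (2 * pi * t)))
        \<longlonglongrightarrow> disc_to_half_plane (of_real 1 * cis (2 * pi * t))"
      unfolding disc_to_half_plane_def by (intro tendsto_intros rlim) (use c1 in auto)
    then have "(\<lambda>n. disc_to_half_plane (of_real (r n) * cis (2 * pi * t))) \<longlonglongrightarrow> of_real (circle_to_line t)"
      by (simp add: disc_to_half_plane_cis)
    moreover have "isCont p (of_real (circle_to_line t))"
      using holomorphic_on_imp_continuous_on[OF p] open_hp \<delta> by (simp add: continuous_on_eq_continuous_at)
    ultimately show ?thesis unfolding f_def by (rule isCont_tendsto_compose[rotated])
  qed
  have "(\<lambda>n. \<integral>t. f (of_real (r n) * cis (2 * pi * t)) \<partial>unit_interval)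
      \<longlonglongrightarrow> (\<integral>t. p (of_real (circle_to_line t)) \<partial>unit_interval)"
  proof (rule integral_dominated_convergence[where w = "\<lambda>_. B"])
    show "(\<lambda>t. p (of_real (circle_to_line t))) \<in> borel_measurable unit_interval"
      using boundary_integrable[OF p \<delta> B] by measurable
    show "(\<lambda>t. f (of_real (r n) * cis (2 * pi * t))) \<in> borel_measurable unit_interval" for n
      by (intro unit_interval_measurable borel_measurable_continuous_onI
            continuous_on_compose2[OF holomorphic_on_imp_continuous_on[OF \<open>f holomorphic_on ball 0 1\<close>]])
         (use r[of n] in \<open>auto intro!: continuous_intros simp: norm_mult\<close>)
    have "AE t in lborel. t \<noteq> (0::real)" "AE t in lborel. t \<noteq> (1::real)"
      by (rule AE_lborel_singleton)+
    then have "AE t in lborel. t \<in> {0..1} \<longrightarrow> 0 < t \<and> t < (1::real)"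
      by eventually_elim auto
    then have "AE t in unit_interval. 0 < t \<and> t < 1"
      by (subst AE_restrict_space_iff) auto
    then show "AE t in unit_interval. (\<lambda>n. f (of_real (r n) * cis (2 * pi * t)))
        \<longlonglongrightarrow> p (of_real (circle_to_line t))"
      by eventually_elim (use lim in auto)
    show "AE t in unit_interval. norm (f (of_real (r n) * cis (2 * pi * t))) \<le> B" for n
      using bnd by simp
  qed simp
  then show ?thesis unfolding mv f0 by (simp add: LIMSEQ_const_iff)
qed

text \<open>Herglotz' formula: \<open>1 / F\<close> is recovered from the boundary values of the bounded function
  \<open>(1 + \<zeta>\<^sup>2) / F \<zeta> - \<zeta>\<close>.\<close>

lemma exists_real_prob_of_boundary_holomorphic:
  assumes F: "F holomorphic_on {z. Im z > - \<delta>}" and \<delta>: "\<delta> > 0"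
    and ImF: "\<And>z. Im z > - \<delta> \<Longrightarrow> Im (F z) \<ge> Im z + \<delta>"
    and C: "\<And>z. Im z \<ge> 0 \<Longrightarrow> norm (F z - z) \<le> C"
  shows "\<exists>\<mu>. real_prob \<mu> \<and> (\<forall>z. Im z > 0 \<longrightarrow> cauchy_G \<mu> z = 1 / F z)"
proof -
  interpret U: prob_space unit_interval by (rule prob_space_unit_interval)
  let ?H = "\<lambda>\<delta>. {z. Im z > - \<delta>}" and ?X = circle_to_line
  have Fnz: "F z \<noteq> 0" if "Im z > - \<delta>" for z using ImF[OF that] that by auto
  have C0: "C \<ge> 0" by (rule order_trans[OF norm_ge_zero C[of 0]]) simp
  \<comment> \<open>By Stieltjes inversion the sought measure should have density - (1 + x^2) Im (1
    / F x) with respect to the standard Cauchy law. Subtracting \<zeta> leaves the imaginary part on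
    the line unchanged and cancels the linear growth at infinity.\<close>
  define q where "q \<zeta> = (1 + \<zeta>\<^sup>2) / F \<zeta> - \<zeta>" for \<zeta>
  \<comment> \<open>From \<open>q \<zeta> = (1 - \<zeta> * (F \<zeta> - \<zeta>)) / F
    \<zeta>\<close> together with |F \<zeta>| \<ge> \<delta> and |\<zeta>| \<le> |F \<zeta>| +
    C.\<close>
  define B where "B = 1 / \<delta> + C * (1 + C / \<delta>)"
  have q_hol: "q holomorphic_on ?H \<delta>"
    unfolding q_def by (intro holomorphic_intros F) (use Fnz in auto)
  have q_bnd: "norm (q \<zeta>) \<le> B" if \<zeta>: "Im \<zeta> \<ge> 0" for \<zeta>
  proof -
    have Im\<zeta>: "Im \<zeta> > - \<delta>" using \<zeta> \<delta> by simp
    have nF: "\<delta> \<le> norm (F \<zeta>)"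
      using ImF[OF Im\<zeta>] abs_Im_le_cmod[of "F \<zeta>"] \<zeta> by linarith
    have pos: "0 < norm (F \<zeta>)" using nF \<delta> by linarith
    have "norm \<zeta> \<le> norm (F \<zeta>) + norm (F \<zeta> - \<zeta>)" using norm_triangle_ineq4[of "F \<zeta>" "F \<zeta> - \<zeta>"] by simp
    then have n\<zeta>: "norm \<zeta> \<le> norm (F \<zeta>) + C" using C[OF \<zeta>] by linarith
    have "q \<zeta> = (1 - \<zeta> * (F \<zeta> - \<zeta>)) / F \<zeta>"
      using Fnz[OF Im\<zeta>] by (simp add: q_def field_simps power2_eq_square)
    then have "norm (q \<zeta>) \<le> (1 + norm \<zeta> * norm (F \<zeta> - \<zeta>)) / norm (F \<zeta>)"
      using norm_triangle_ineq4[of 1 "\<zeta> * (F \<zeta> - \<zeta>)"]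
      by (auto simp: norm_divide norm_mult intro!: divide_right_mono)
    also have "\<dots> \<le> (1 + (norm (F \<zeta>) + C) * C) / norm (F \<zeta>)"
      using C[OF \<zeta>] n\<zeta> C0 by (intro divide_right_mono add_left_mono mult_mono add_nonneg_nonneg) auto
    also have "\<dots> = 1 / norm (F \<zeta>) + C * (1 + C / norm (F \<zeta>))"
      using pos by (simp add: field_simps)
    also have "\<dots> \<le> B"
      unfolding B_def using nF \<delta> C0 by (intro add_mono mult_left_mono frac_le) auto
    finally show ?thesis .
  qed
  \<comment> \<open>The factor 1 + \<zeta>^2 vanishes at i, so the mean value of \<open>q\<close>
    does not depend on F, and the density \<open>d\<close> has total mass exactly 1.\<close>
  have qi: "q \<i> = - \<i>" by (simp add: q_def)
  have q_int: "integrable unit_interval (\<lambda>t. q (of_real (?X t)))"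
    by (rule boundary_integrable[OF q_hol \<delta> q_bnd])
  have q_mean: "(\<integral>t. q (of_real (?X t)) \<partial>unit_interval) = - \<i>"
    using boundary_mean_value[OF q_hol \<delta> q_bnd] qi by simp

  define d where "d x = - Im (q (of_real x))" for x
  have d_nonneg: "d x \<ge> 0" for x
  proof -
    have "Im (F (of_real x)) \<ge> 0" using ImF[of "of_real x"] \<delta> by simp
    have "q (of_real x) = of_real (1 + x\<^sup>2) * (1 / F (of_real x)) - of_real x" by (simp add: q_def)
    moreover have "Im (of_real a * w - of_real x) = a * Im w" for a w by simp
    ultimately have "d x = (1 + x\<^sup>2) * (- Im (1 / F (of_real x)))"
      unfolding d_def by (simp only: mult_minus_right)
    also have "- Im (1 / F (of_real x)) = Im (F (of_real x)) / (norm (F (of_real x)))\<^sup>2"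
      by (simp add: Im_divide cmod_power2)
    finally show ?thesis using \<open>Im (F (of_real x)) \<ge> 0\<close> by (auto intro!: mult_nonneg_nonneg add_nonneg_nonneg)
  qed
  have d_meas [measurable]: "d \<in> borel_measurable borel"
    unfolding d_def
    by (intro borel_measurable_continuous_onI continuous_intros
          continuous_on_compose2[OF holomorphic_on_imp_continuous_on[OF q_hol]])
       (use \<delta> in \<open>auto intro!: continuous_intros\<close>)
  have dX_int: "integrable unit_interval (\<lambda>t. d (?X t))"
    unfolding d_def by (intro Bochner_Integration.integrable_minus integrable_Im q_int)
  have dX_mean: "(\<integral>t. d (?X t) \<partial>unit_interval) = 1"
    unfolding d_def Bochner_Integration.integral_minus integral_Im[OF q_int] q_mean by simp
  have X_meas [measurable]: "?X \<in> borel_measurable unit_interval"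
    by (rule unit_interval_measurable) measurable
  have dX_meas [measurable]: "(\<lambda>t. d (?X t)) \<in> borel_measurable unit_interval"
    by measurable

  define M where "M = density unit_interval (\<lambda>t. ennreal (d (?X t)))"
  define \<mu> where "\<mu> = distr M borel ?X"
  have "emeasure M (space M) = (\<integral>\<^sup>+t. ennreal (d (?X t)) * indicator (space unit_interval) t \<partial>unit_interval)"
    unfolding M_def space_density by (rule emeasure_density[OF _ sets.top]) measurable
  also have "\<dots> = (\<integral>\<^sup>+t. ennreal (d (?X t)) \<partial>unit_interval)"
    by (rule nn_integral_cong) (simp only: indicator_simps mult_1_right)
  also have "\<dots> = ennreal (\<integral>t. d (?X t) \<partial>unit_interval)"
    by (rule nn_integral_eq_integral[OF dX_int]) (use d_nonneg in auto)
  finally have "prob_space M" unfolding dX_mean by (intro prob_spaceI) simp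
  moreover have XM: "?X \<in> borel_measurable M" by (simp add: M_def)
  ultimately have rp: "real_prob \<mu>"
    unfolding real_prob_def \<mu>_def by (simp add: prob_space.prob_space_distr)
  have G_int: "cauchy_G \<mu> z = (\<integral>t. of_real (d (?X t)) * (1 / (z - of_real (?X t))) \<partial>unit_interval)" for z
    unfolding cauchy_G_def \<mu>_def
    by (subst integral_distr[OF XM], simp)
       (simp add: M_def integral_density d_nonneg scaleR_conv_of_real)

  \<comment> \<open>The point i is excluded because the partial fractions below divide by z - i; the
    value there follows by continuity.\<close>
  have G_eq: "cauchy_G \<mu> z = 1 / F z" if z: "Im z > 0" and "z \<noteq> \<i>" for z
  proof -
    \<comment> \<open>The pole at the conjugate of z has imaginary part - Im z, so the quotients
      below are holomorphic only above the higher of the lines - \<delta> and - Im z.\<close>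
    define \<epsilon> where "\<epsilon> = min \<delta> (Im z)"
    have \<epsilon>: "\<epsilon> > 0" "\<epsilon> \<le> \<delta>" "\<epsilon> \<le> Im z" using \<delta> z by (auto simp: \<epsilon>_def)
    have far: "Im z \<le> norm (cnj z - \<zeta>)" if "Im \<zeta> \<ge> 0" for \<zeta>
      using abs_Im_le_cmod[of "cnj z - \<zeta>"] that z by simp
    have cnz: "cnj z - \<zeta> \<noteq> 0" if "Im \<zeta> > - \<epsilon>" for \<zeta>
      using that \<epsilon> by (auto simp: complex_eq_iff)
    have sub: "?H \<epsilon> \<subseteq> ?H \<delta>" using \<epsilon> by auto

    have r_hol: "(\<lambda>\<zeta>. 1 / (cnj z - \<zeta>)) holomorphic_on ?H \<epsilon>"
      by (intro holomorphic_intros) (use cnz in auto)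
    have r_bnd: "norm (1 / (cnj z - \<zeta>)) \<le> 1 / Im z" if "Im \<zeta> \<ge> 0" for \<zeta>
      using far[OF that] z by (auto simp: norm_divide intro!: frac_le)
    have r: "integrable unit_interval (\<lambda>t. 1 / (cnj z - of_real (?X t)))"
        "(\<integral>t. 1 / (cnj z - of_real (?X t)) \<partial>unit_interval) = 1 / (cnj z - \<i>)"
      by (rule boundary_integrable[OF r_hol \<epsilon>(1) r_bnd] boundary_mean_value[OF r_hol \<epsilon>(1) r_bnd]; assumption)+

    have s_hol: "(\<lambda>\<zeta>. q \<zeta> / (cnj z - \<zeta>)) holomorphic_on ?H \<epsilon>"
      by (intro holomorphic_intros holomorphic_on_subset[OF q_hol sub]) (use cnz in auto)
    have s_bnd: "norm (q \<zeta> / (cnj z - \<zeta>)) \<le> B / Im z" if "Im \<zeta> \<ge> 0" for \<zeta>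
      using far[OF that] z q_bnd[OF that] by (auto simp: norm_divide intro!: frac_le order_trans[OF norm_ge_zero])
    have s: "integrable unit_interval (\<lambda>t. q (of_real (?X t)) / (cnj z - of_real (?X t)))"
        "(\<integral>t. q (of_real (?X t)) / (cnj z - of_real (?X t)) \<partial>unit_interval) = - \<i> / (cnj z - \<i>)"
      using boundary_integrable[OF s_hol \<epsilon>(1) s_bnd] boundary_mean_value[OF s_hol \<epsilon>(1) s_bnd] qi by auto

    \<comment> \<open>The kernel 1 / (z - x) has its pole inside the upper half-plane, where the
      mean value property would fail. Subtracting \<open>q z\<close> removes that pole.\<close>
    define p where "p = (\<lambda>\<zeta>. if \<zeta> = z then deriv q z else (q \<zeta> - q z) / (\<zeta> - z))"
    have p_hol: "p holomorphic_on ?H \<delta>"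
      unfolding p_def by (rule pole_lemma_open[OF q_hol open_halfspace_Im_gt])
    have "cball z (Im z) \<subseteq> ?H \<delta>"
    proof
      fix \<zeta> assume "\<zeta> \<in> cball z (Im z)"
      then have "\<bar>Im (z - \<zeta>)\<bar> \<le> Im z" using abs_Im_le_cmod[of "z - \<zeta>"] by (simp add: dist_norm)
      then show "\<zeta> \<in> ?H \<delta>" using \<delta> by simp
    qed
    then have "compact (p ` cball z (Im z))"
      by (intro compact_continuous_image holomorphic_on_imp_continuous_on holomorphic_on_subset[OF p_hol]) auto
    then obtain K where K: "\<And>\<zeta>. \<zeta> \<in> cball z (Im z) \<Longrightarrow> norm (p \<zeta>) \<le> K"
      using compact_imp_bounded by (force simp: bounded_iff)
    have p_bnd: "norm (p \<zeta>) \<le> max K (2 * B / Im z)" if \<zeta>: "Im \<zeta> \<ge> 0" for \<zeta>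
    proof (cases "\<zeta> \<in> cball z (Im z)")
      case True
      then show ?thesis using K by (simp add: max.coboundedI1)
    next
      case False
      then have *: "Im z \<le> norm (\<zeta> - z)" "\<zeta> \<noteq> z" using z by (auto simp: dist_norm norm_minus_commute)
      have "norm (p \<zeta>) = norm (q \<zeta> - q z) / norm (\<zeta> - z)" using * by (simp add: p_def norm_divide)
      also have "\<dots> \<le> (2 * B) / Im z"
        using * z q_bnd[OF \<zeta>] q_bnd[of z] norm_triangle_ineq4[of "q \<zeta>" "q z"]
        by (intro frac_le) (auto intro: order_trans[OF norm_ge_zero])
      finally show ?thesis by (rule max.coboundedI2)
    qed
    have p: "integrable unit_interval (\<lambda>t. p (of_real (?X t)))"
        "(\<integral>t. p (of_real (?X t)) \<partial>unit_interval) = (q \<i> - q z) / (\<i> - z)"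
      using boundary_integrable[OF p_hol \<delta> p_bnd] boundary_mean_value[OF p_hol \<delta> p_bnd] \<open>z \<noteq> \<i>\<close>
      by (auto simp: p_def)

    \<comment> \<open>Write - Im q as (i / 2) times q minus its conjugate. The part with q uses
      \<open>p\<close>; the remaining term with \<open>q z\<close> and the part with the conjugate
      of q are conjugates of functions whose pole lies at the conjugate of z, below the line. Each
      piece can now be evaluated at i by the mean value property.\<close>
    have split: "of_real (d x) * (1 / (z - of_real x))
        = (\<i> / 2) * ((- p (of_real x) + q z * cnj (1 / (cnj z - of_real x))) - cnj (q (of_real x) / (cnj z - of_real x)))"
      for x
    proof -
      have ne: "of_real x \<noteq> z" "z - of_real x \<noteq> 0" using z by (auto simp: complex_eq_iff)
      have dx: "of_real (d x) = (\<i> / 2) * (q (of_real x) - cnj (q (of_real x)))"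
        by (simp add: d_def complex_eq_iff)
      have "- p (of_real x) + q z * cnj (1 / (cnj z - of_real x)) = q (of_real x) * (1 / (z - of_real x))"
      proof -
        have "- p (of_real x) = (q (of_real x) - q z) / (z - of_real x)"
          using ne by (simp add: p_def) (metis minus_diff_eq minus_divide_right)
        then show ?thesis using ne by (simp add: diff_divide_distrib)
      qed
      moreover have "cnj (q (of_real x) / (cnj z - of_real x)) = cnj (q (of_real x)) * (1 / (z - of_real x))"
        by simp
      ultimately show ?thesis unfolding dx by (simp only: mult.assoc left_diff_distrib)
    qed
    have "cauchy_G \<mu> z = (\<i> / 2) * ((- ((q \<i> - q z) / (\<i> - z)) + q z * cnj (1 / (cnj z - \<i>))) - cnj (- \<i> / (cnj z - \<i>)))"
      unfolding G_int split integral_mult_right_zero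
      by (subst Bochner_Integration.integral_diff,
          (intro Bochner_Integration.integrable_add Bochner_Integration.integrable_minus
            integrable_mult_right integrable_cnj p r s)+,
          subst Bochner_Integration.integral_add,
          (intro Bochner_Integration.integrable_minus integrable_mult_right integrable_cnj p r)+)
         (simp only: integral_mult_right_zero Bochner_Integration.integral_minus
            Bochner_Integration.integral_cnj p r s)
    also have "\<dots> = (\<i> / 2) * ((- \<i> - q z) / (z - \<i>) + q z / (z + \<i>) - \<i> / (z + \<i>))"
    proof -
      have "- ((q \<i> - q z) / (\<i> - z)) = (- \<i> - q z) / (z - \<i>)"
        unfolding qi by (metis minus_diff_eq minus_divide_right)
      then show ?thesis by simp
    qed
    also have "\<dots> = (q z + z) / (1 + z\<^sup>2)"
    proof -
      have "z + \<i> \<noteq> 0" using z by (auto simp: complex_eq_iff)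
      moreover have "z - \<i> \<noteq> 0" using \<open>z \<noteq> \<i>\<close> by simp
      moreover have f: "1 + z\<^sup>2 = (z - \<i>) * (z + \<i>)" by (simp add: algebra_simps power2_eq_square)
      ultimately have "(- \<i> - q z) / (z - \<i>) + q z / (z + \<i>) - \<i> / (z + \<i>)
          = ((- \<i> - q z) * (z + \<i>) + q z * (z - \<i>) - \<i> * (z - \<i>)) / ((z - \<i>) * (z + \<i>))"
        by (simp add: add_divide_distrib diff_divide_distrib)
      also have "(- \<i> - q z) * (z + \<i>) + q z * (z - \<i>) - \<i> * (z - \<i>) = - 2 * \<i> * (q z + z)"
        by (simp add: algebra_simps)
      finally have "(- \<i> - q z) / (z - \<i>) + q z / (z + \<i>) - \<i> / (z + \<i>)
          = (- 2 * \<i> * (q z + z)) / (1 + z\<^sup>2)" unfolding f .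
      moreover have "(\<i> / 2) * (- 2 * \<i> * a) = a" for a by simp
      ultimately show ?thesis by (simp only: times_divide_eq_right)
    qed
    also have "\<dots> = 1 / F z"
    proof -
      have "1 + z\<^sup>2 = (z - \<i>) * (z + \<i>)" by (simp add: algebra_simps power2_eq_square)
      moreover have "z + \<i> \<noteq> 0" using z by (auto simp: complex_eq_iff)
      ultimately have "1 + z\<^sup>2 \<noteq> 0" using \<open>z \<noteq> \<i>\<close> by simp
      then show ?thesis by (simp add: q_def)
    qed
    finally show ?thesis .
  qed
  have "cauchy_G \<mu> z = 1 / F z" if z: "Im z > 0" for z
  proof (cases "z = \<i>")
    case True
    have "isCont (\<lambda>z. 1 / F z) \<i>"
      using holomorphic_on_imp_continuous_on[OF F] \<delta> Fnz[of \<i>]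
      by (intro continuous_intros) (auto simp: continuous_on_eq_continuous_at open_halfspace_Im_gt)
    then have "((\<lambda>z. 1 / F z) \<longlongrightarrow> 1 / F \<i>) (at \<i>)" by (simp add: isCont_def)
    moreover have "\<forall>\<^sub>F z in at \<i>. 1 / F z = cauchy_G \<mu> z"
    proof -
      have "\<forall>\<^sub>F z in at \<i>. Im z > 0" by (rule order_tendstoD(1)[OF tendsto_Im[OF tendsto_ident_at]]) simp
      moreover have "\<forall>\<^sub>F z in at \<i>. z \<noteq> \<i>" by (simp add: eventually_at_filter)
      ultimately show ?thesis by eventually_elim (use G_eq in auto)
    qed
    ultimately have "(cauchy_G \<mu> \<longlongrightarrow> 1 / F \<i>) (at \<i>)" by (rule Lim_transform_eventually)
    moreover have "(cauchy_G \<mu> \<longlongrightarrow> cauchy_G \<mu> \<i>) (at \<i>)"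
      using isCont_cauchy_G[OF rp, of \<i>] by (simp add: isCont_def)
    ultimately show ?thesis unfolding True by (rule LIM_unique[symmetric])
  qed (use G_eq z in blast)
  with rp show ?thesis by blast
qed

section \<open>Tightness and removal of the shift\<close>

text \<open>The real part of 1 - i y / (i y - x) is x^2 / (x^2 + y^2), which is at least 1 / 2 once
  |x| \<ge> y. Tails are thus controlled by the transform at a single point.\<close>

lemma real_prob_tail_le:
  assumes \<mu>: "real_prob \<mu>" and y: "y > 0"
  shows "measure \<mu> {x. y \<le> \<bar>x\<bar>} \<le> 2 * norm (1 - \<i> * of_real y * cauchy_G \<mu> (\<i> * of_real y))"
proof -
  interpret prob_space \<mu> using \<mu> by (rule real_prob_imp_prob_space)
  let ?f = "\<lambda>x. 1 - \<i> * of_real y * (1 / (\<i> * of_real y - complex_of_real x))"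
  have int: "integrable \<mu> (\<lambda>x. 1 / (\<i> * of_real y - complex_of_real x))"
    by (rule integrable_resolvent[OF \<mu>]) (use y in simp)
  have fint: "integrable \<mu> ?f"
    by (intro Bochner_Integration.integrable_diff integrable_mult_right int) simp
  have Re_f: "Re (?f x) = x\<^sup>2 / (x\<^sup>2 + y\<^sup>2)" for x
  proof -
    have ne: "\<i> * of_real y - complex_of_real x \<noteq> 0" using y by (auto simp: complex_eq_iff)
    have pos: "x\<^sup>2 + y\<^sup>2 \<noteq> 0" using y by (simp add: sum_power2_eq_zero_iff)
    have "?f x = - of_real x / (\<i> * of_real y - complex_of_real x)"
      using ne by (simp add: field_simps)
    then show ?thesis using pos by (simp add: Re_divide power2_eq_square)
  qed
  have S: "{x. y \<le> \<bar>x\<bar>} \<in> sets \<mu>"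
    unfolding real_prob_sets[OF \<mu>] by measurable
  have "measure \<mu> {x. y \<le> \<bar>x\<bar>} = (\<integral>x. indicator {x. y \<le> \<bar>x\<bar>} x \<partial>\<mu>)"
    using S sets.sets_into_space[OF S] by (simp add: Int_absorb2)
  also have "\<dots> \<le> (\<integral>x. 2 * Re (?f x) \<partial>\<mu>)"
  proof (rule integral_mono_AE)
    show "integrable \<mu> (indicator {x. y \<le> \<bar>x\<bar>} :: real \<Rightarrow> real)"
      using S by (simp add: emeasure_eq_measure)
    show "integrable \<mu> (\<lambda>x. 2 * Re (?f x))" by (intro integrable_mult_right integrable_Re fint)
    show "AE x in \<mu>. indicator {x. y \<le> \<bar>x\<bar>} x \<le> 2 * Re (?f x)"
    proof (intro always_eventually allI)
      fix x :: real
      show "indicator {x. y \<le> \<bar>x\<bar>} x \<le> 2 * Re (?f x)"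
      proof (cases "y \<le> \<bar>x\<bar>")
        case True
        then have "y\<^sup>2 \<le> x\<^sup>2" using y by (metis abs_le_square_iff abs_of_pos)
        moreover have "y\<^sup>2 > 0" using y by simp
        moreover from this have "x\<^sup>2 + y\<^sup>2 > 0" by (intro add_nonneg_pos) auto
        ultimately show ?thesis using True unfolding Re_f by (simp add: pos_le_divide_eq)
      next
        case False
        then show ?thesis unfolding Re_f by simp
      qed
    qed
  qed
  also have "\<dots> = 2 * Re (\<integral>x. ?f x \<partial>\<mu>)"
    by (simp only: integral_mult_right_zero integral_Re[OF fint])
  also have "(\<integral>x. ?f x \<partial>\<mu>) = 1 - \<i> * of_real y * cauchy_G \<mu> (\<i> * of_real y)"
    unfolding cauchy_G_def
    by (subst Bochner_Integration.integral_diff)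
       (simp_all only: integrable_const integrable_mult_right int integral_mult_right_zero
          lebesgue_integral_const prob_space scaleR_one)
  also have "2 * Re (1 - \<i> * of_real y * cauchy_G \<mu> (\<i> * of_real y))
      \<le> 2 * norm (1 - \<i> * of_real y * cauchy_G \<mu> (\<i> * of_real y))"
    by (intro mult_left_mono complex_Re_le_cmod) simp
  finally show ?thesis .
qed

lemma real_prob_imp_real_distribution: "real_prob \<mu> \<Longrightarrow> real_distribution \<mu>"
  by (simp add: real_prob_def real_distribution_def real_distribution_axioms_def sets_eq_imp_space_eq)

text \<open>The bound on F z - z over Im z \<ge> \<epsilon> has two uses. For each \<epsilon> it
  makes the shifted function admissible for the boundary construction, and at height 1 it controls
  the tails of all approximating measures at once, so no mass escapes in the limit.\<close>

lemma exists_real_prob_of_holomorphic: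
  assumes F: "F holomorphic_on {z. Im z > 0}"
    and ImF: "\<And>z. Im z > 0 \<Longrightarrow> Im (F z) \<ge> Im z"
    and bdd: "\<And>\<epsilon>. \<epsilon> > 0 \<Longrightarrow> \<exists>C. \<forall>z. Im z \<ge> \<epsilon> \<longrightarrow> norm (F z - z) \<le> C"
  shows "\<exists>\<mu>. real_prob \<mu> \<and> (\<forall>z. Im z > 0 \<longrightarrow> cauchy_G \<mu> z = 1 / F z)"
proof -
  define \<epsilon> where "\<epsilon> n = 1 / real (Suc n)" for n
  have \<epsilon>: "0 < \<epsilon> n" "\<epsilon> n \<le> 1" for n by (auto simp: \<epsilon>_def)
  have \<epsilon>_lim: "\<epsilon> \<longlonglongrightarrow> 0" unfolding \<epsilon>_def by (rule LIMSEQ_Suc[OF lim_inverse_n'])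
  have ex: "\<exists>\<mu>. real_prob \<mu> \<and> (\<forall>z. Im z > 0 \<longrightarrow> cauchy_G \<mu> z = 1 / F (z + \<i> * of_real (\<epsilon> n)))" for n
  proof -
    obtain C where C: "\<And>z. Im z \<ge> \<epsilon> n \<Longrightarrow> norm (F z - z) \<le> C" using bdd[OF \<epsilon>(1)] by blast
    show ?thesis
    proof (rule exists_real_prob_of_boundary_holomorphic[where \<delta> = "\<epsilon> n" and C = "C + 1"])
      show "(\<lambda>z. F (z + \<i> * of_real (\<epsilon> n))) holomorphic_on {z. Im z > - \<epsilon> n}"
        by (rule holomorphic_on_compose_gen[OF _ F, unfolded o_def]) (auto intro!: holomorphic_intros)
      show "Im z + \<epsilon> n \<le> Im (F (z + \<i> * of_real (\<epsilon> n)))" if "Im z > - \<epsilon> n" for z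
        using ImF[of "z + \<i> * of_real (\<epsilon> n)"] that by simp
      show "norm (F (z + \<i> * of_real (\<epsilon> n)) - z) \<le> C + 1" if "Im z \<ge> 0" for z
      proof -
        have "norm (F (z + \<i> * of_real (\<epsilon> n)) - (z + \<i> * of_real (\<epsilon> n))) \<le> C" by (rule C) (use that in simp)
        moreover have "norm (\<i> * of_real (\<epsilon> n)) \<le> 1" using \<epsilon>[of n] by (simp add: norm_mult)
        ultimately show ?thesis
          using norm_triangle_ineq[of "F (z + \<i> * of_real (\<epsilon> n)) - (z + \<i> * of_real (\<epsilon> n))" "\<i> * of_real (\<epsilon> n)"]
          by simp
      qed
    qed (rule \<epsilon>)
  qed
  then obtain \<mu> where \<mu>: "\<And>n. real_prob (\<mu> n)"
    and G: "\<And>n z. Im z > 0 \<Longrightarrow> cauchy_G (\<mu> n) z = 1 / F (z + \<i> * of_real (\<epsilon> n))"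
    by metis
  obtain C where C: "\<And>z. Im z \<ge> 1 \<Longrightarrow> norm (F z - z) \<le> C" using bdd[of 1] by auto
  have C0: "C \<ge> 0" by (rule order_trans[OF norm_ge_zero C[of \<i>]]) simp
  \<comment> \<open>Here 1 - z G z = (F w - z) / F w with w = z + i \<epsilon>, and |F w| \<ge> Im w
    \<ge> y. The 1 in C + 1 absorbs the shift, as \<epsilon> \<le> 1.\<close>
  have tail: "measure (\<mu> n) {x. y \<le> \<bar>x\<bar>} \<le> 2 * (C + 1) / y" if y: "y \<ge> 1" for n y
  proof -
    let ?z = "\<i> * complex_of_real y" and ?w = "\<i> * complex_of_real y + \<i> * of_real (\<epsilon> n)"
    have w: "Im ?w \<ge> y" using \<epsilon>[of n] by simp
    have nF: "y \<le> norm (F ?w)" using ImF[of ?w] w y abs_Im_le_cmod[of "F ?w"] by linarith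
    have "F ?w \<noteq> 0" using nF y by auto
    have "norm (F ?w - ?z) \<le> C + 1"
    proof -
      have "norm (F ?w - ?w) \<le> C" by (rule C) (use w y in linarith)
      moreover have "norm (\<i> * of_real (\<epsilon> n)) \<le> 1" using \<epsilon>[of n] by (simp add: norm_mult)
      ultimately show ?thesis
        using norm_triangle_ineq[of "F ?w - ?w" "\<i> * of_real (\<epsilon> n)"] by simp
    qed
    have "1 - ?z * cauchy_G (\<mu> n) ?z = (F ?w - ?z) / F ?w"
      using G[of ?z n] y \<open>F ?w \<noteq> 0\<close> by (simp add: diff_divide_distrib)
    then have "norm (1 - ?z * cauchy_G (\<mu> n) ?z) = norm (F ?w - ?z) / norm (F ?w)" by (simp add: norm_divide)
    also have "\<dots> \<le> (C + 1) / y"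
      by (rule frac_le) (use \<open>norm (F ?w - ?z) \<le> C + 1\<close> nF y C0 in auto)
    finally have N: "norm (1 - ?z * cauchy_G (\<mu> n) ?z) \<le> (C + 1) / y" .
    have "measure (\<mu> n) {x. y \<le> \<bar>x\<bar>} \<le> 2 * norm (1 - ?z * cauchy_G (\<mu> n) ?z)"
      by (rule real_prob_tail_le[OF \<mu>]) (use y in simp)
    also have "\<dots> \<le> 2 * ((C + 1) / y)" using N by (intro mult_left_mono) auto
    finally show ?thesis by (simp only: times_divide_eq_right)
  qed
  have "tight \<mu>"
    unfolding tight_def
  proof (intro conjI allI impI)
    show "real_distribution (\<mu> n)" for n by (rule real_prob_imp_real_distribution[OF \<mu>])
    fix e :: real assume e: "e > 0"
    define y where "y = max 1 (2 * (C + 1) / e) + 1"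
    have y: "y \<ge> 1" "y > 2 * (C + 1) / e" by (auto simp: y_def)
    have "1 - e < measure (\<mu> n) {- y<..y}" for n
    proof -
      interpret prob_space "\<mu> n" using \<mu> by (rule real_prob_imp_prob_space)
      have sets: "sets (\<mu> n) = sets borel" by (rule real_prob_sets[OF \<mu>])
      have "space (\<mu> n) - {- y<..y} \<subseteq> {x. y \<le> \<bar>x\<bar>}" by auto
      then have "measure (\<mu> n) (space (\<mu> n) - {- y<..y}) \<le> measure (\<mu> n) {x. y \<le> \<bar>x\<bar>}"
        by (rule finite_measure_mono) (simp add: sets)
      also have "\<dots> \<le> 2 * (C + 1) / y" by (rule tail[OF y(1)])
      also have "\<dots> < e" using y e by (simp add: field_simps)
      finally show ?thesis by (subst (asm) prob_compl) (auto simp: sets)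
    qed
    then show "\<exists>a b. a < b \<and> (\<forall>n. 1 - e < measure (\<mu> n) {a<..b})"
      using y by (intro exI[of _ "- y"] exI[of _ y]) auto
  qed
  \<comment> \<open>A weak limit along a subsequence is enough: the resolvent is bounded and
    continuous, and the transforms converge to 1 / F as \<epsilon> -> 0.\<close>
  from tight_imp_convergent_subsubsequence[OF this strict_mono_id]
  obtain r M where r: "strict_mono r" and M: "real_distribution M" and weak: "weak_conv_m (\<mu> \<circ> id \<circ> r) M"
    by blast
  have rp: "real_prob M"
    using M by (auto simp: real_prob_def real_distribution_def real_distribution_axioms_def)
  have "cauchy_G M z = 1 / F z" if z: "Im z > 0" for z
  proof -
    have "(\<lambda>n. \<integral>x. 1 / (z - complex_of_real x) \<partial>(\<mu> \<circ> id \<circ> r) n) \<longlonglongrightarrow> (\<integral>x. 1 / (z - complex_of_real x) \<partial>M)"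
    proof (rule weak_conv_imp_integral_bdd_continuous_conv[OF _ M weak])
      show "real_distribution ((\<mu> \<circ> id \<circ> r) n)" for n
        using real_prob_imp_real_distribution[OF \<mu>] by simp
      show "isCont (\<lambda>x. 1 / (z - complex_of_real x)) x" for x
        using z by (intro continuous_intros) (auto simp: complex_eq_iff)
    qed (rule norm_resolvent_le[OF z])
    then have "(\<lambda>n. cauchy_G (\<mu> (r n)) z) \<longlonglongrightarrow> cauchy_G M z" by (simp add: cauchy_G_def)
    then have lim1: "(\<lambda>n. 1 / F (z + \<i> * of_real (\<epsilon> (r n)))) \<longlonglongrightarrow> cauchy_G M z" by (simp add: G[OF z])
    have "(\<lambda>n. z + \<i> * complex_of_real (\<epsilon> (r n))) \<longlonglongrightarrow> z + \<i> * of_real 0"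
      by (intro tendsto_intros LIMSEQ_subseq_LIMSEQ[OF \<epsilon>_lim r, unfolded o_def])
    then have "(\<lambda>n. z + \<i> * complex_of_real (\<epsilon> (r n))) \<longlonglongrightarrow> z" by simp
    moreover have "isCont F z"
      using holomorphic_on_imp_continuous_on[OF F] z
      by (auto simp: continuous_on_eq_continuous_at open_halfspace_Im_gt)
    ultimately have "(\<lambda>n. F (z + \<i> * of_real (\<epsilon> (r n)))) \<longlonglongrightarrow> F z"
      by (rule isCont_tendsto_compose[rotated])
    moreover have "F z \<noteq> 0" using ImF[OF z] z by auto
    ultimately have "(\<lambda>n. 1 / F (z + \<i> * of_real (\<epsilon> (r n)))) \<longlonglongrightarrow> 1 / F z"
      by (intro tendsto_intros)
    with lim1 show ?thesis by (rule LIMSEQ_unique)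
  qed
  with rp show ?thesis by blast
qed

section \<open>The image and the fibres of the wrapping map\<close>

text \<open>The quotient \<eta> q / q, with the derivative of \<eta> at 0 as its value there. The
  two conditions that define \<open>class_ID_star\<close> thus merge into one: this function has no
  zero in the disc.\<close>

definition eta_quot :: "complex measure \<Rightarrow> complex \<Rightarrow> complex" where
  "eta_quot \<nu> q = chi_T \<nu> q / (1 + psi_T \<nu> q)"

lemma eta_T_eq_eta_quot: "eta_T \<nu> q = q * eta_quot \<nu> q"
  by (simp add: eta_T_def eta_quot_def psi_T_eq_chi_T)

lemma eta_quot_holomorphic:
  assumes "circle_prob \<nu>"
  shows "eta_quot \<nu> holomorphic_on ball 0 1"
proof -
  have "(\<lambda>q. chi_T \<nu> q / (1 + q * chi_T \<nu> q)) holomorphic_on ball 0 1"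
    by (intro holomorphic_intros chi_T_holomorphic assms)
       (use one_plus_psi_T_nonzero[OF assms] in \<open>auto simp: psi_T_eq_chi_T\<close>)
  then show ?thesis by (simp add: eta_quot_def[abs_def] psi_T_eq_chi_T)
qed

lemma eta_quot_differentiable_0:
  assumes "circle_prob \<nu>"
  shows "(eta_quot \<nu> has_field_derivative deriv (eta_quot \<nu>) 0) (at 0)"
  by (rule holomorphic_derivI[OF eta_quot_holomorphic[OF assms]]) auto

lemma deriv_eta_T_0:
  assumes "circle_prob \<nu>"
  shows "deriv (eta_T \<nu>) 0 = eta_quot \<nu> 0"
proof (rule DERIV_imp_deriv)
  show "(eta_T \<nu> has_field_derivative eta_quot \<nu> 0) (at 0)"
    unfolding eta_T_eq_eta_quot[abs_def]
    using DERIV_mult[OF DERIV_ident eta_quot_differentiable_0[OF assms]] by simp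
qed

lemma norm_eta_T_less_one:
  assumes "circle_prob \<nu>" "norm q < 1"
  shows "norm (eta_T \<nu> q) < 1"
proof -
  let ?p = "psi_T \<nu> q"
  have "(norm ?p)\<^sup>2 < (norm (1 + ?p))\<^sup>2"
    using Re_one_plus_two_psi_T_pos[OF assms] unfolding cmod_power2
    by (simp add: power2_eq_square algebra_simps)
  then have "norm ?p < norm (1 + ?p)" by (rule power_less_imp_less_base) simp
  then show ?thesis by (simp add: eta_T_def norm_divide divide_less_eq)
qed

text \<open>Under q = exp (i z) this estimate becomes Im (F z) \<ge> Im z.\<close>

lemma norm_eta_T_le:
  assumes \<nu>: "circle_prob \<nu>" and q: "norm q < 1"
  shows "norm (eta_T \<nu> q) \<le> norm q"
proof (rule Schwarz_Lemma(1)[OF _ _ norm_eta_T_less_one[OF \<nu>] q])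
  show "eta_T \<nu> holomorphic_on ball 0 1"
    unfolding eta_T_eq_eta_quot[abs_def] by (intro holomorphic_intros eta_quot_holomorphic \<nu>)
qed (auto simp: eta_T_eq_eta_quot)

lemma circle_prob_eqI_eta_T:
  assumes \<nu>: "circle_prob \<nu>" and \<nu>': "circle_prob \<nu>'"
    and eta: "\<And>q. 0 < norm q \<Longrightarrow> norm q < 1 \<Longrightarrow> eta_T \<nu> q = eta_T \<nu>' q"
  shows "\<nu> = \<nu>'"
proof (rule circle_prob_eqI_psi_T[OF \<nu> \<nu>'])
  fix q :: complex assume q: "0 < norm q" "norm q < 1"
  have inv: "1 / (1 + psi_T \<rho> q) = 1 - eta_T \<rho> q" if "circle_prob \<rho>" for \<rho>
    using one_plus_psi_T_nonzero[OF that q(2)] by (simp add: eta_T_def field_simps)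
  have "1 / (1 + psi_T \<nu> q) = 1 / (1 + psi_T \<nu>' q)"
    by (simp only: inv \<nu> \<nu>' eta[OF q])
  then show "psi_T \<nu> q = psi_T \<nu>' q" by simp
qed

lemma exists_exp_i_eq:
  assumes "0 < norm q" "norm q < 1"
  obtains z where "Im z > 0" "exp (\<i> * z) = q"
proof
  have "q \<noteq> 0" using assms by auto
  then show "Im (- \<i> * Ln q) > 0" using assms by simp
  show "exp (\<i> * (- \<i> * Ln q)) = q" using \<open>q \<noteq> 0\<close> by simp
qed

text \<open>Away from 0, \<eta> is an exponential and has no zeros. The behaviour at 0 is seen only
  as Im z tends to infinity, where the total mass of \<mu> decides it.\<close>

lemma wrap_in_class_ID_star:
  assumes \<mu>: "\<mu> \<in> class_L"
  shows "wrap \<mu> \<in> class_ID_star"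
proof -
  let ?\<nu> = "wrap \<mu>"
  note rp = class_L_real_prob[OF \<mu>]
  note \<nu> = circle_prob_wrap[OF rp]
  have "q = 0" if "q \<in> ball 0 1" "eta_T ?\<nu> q = 0" for q
  proof (rule ccontr)
    assume "q \<noteq> 0"
    with that(1) have "0 < norm q" "norm q < 1" by auto
    then obtain z where "Im z > 0" "exp (\<i> * z) = q" by (rule exists_exp_i_eq)
    with eta_T_wrap[OF \<mu>, of z] that(2) show False by simp
  qed
  moreover have "deriv (eta_T ?\<nu>) 0 \<noteq> 0"
  proof
    assume "deriv (eta_T ?\<nu>) 0 = 0"
    then have H0: "eta_quot ?\<nu> 0 = 0" unfolding deriv_eta_T_0[OF \<nu>] .
    \<comment> \<open>Near 0 this bounds |\<eta> q| by K |q|^2 if the derivative of \<eta> vanishes;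
      the added 1 makes the bound strict and K positive, so that ln K can serve as the
      constant.\<close>
    define K where "K = norm (deriv (eta_quot ?\<nu>) 0) + 1"
    have K: "K > 0" by (simp add: K_def add_nonneg_pos)
    have "((\<lambda>q. (eta_quot ?\<nu> q - eta_quot ?\<nu> 0) / (q - 0)) \<longlongrightarrow> deriv (eta_quot ?\<nu>) 0) (at 0)"
      using eta_quot_differentiable_0[OF \<nu>] unfolding has_field_derivative_iff .
    then have "((\<lambda>q. norm (eta_quot ?\<nu> q / q)) \<longlongrightarrow> norm (deriv (eta_quot ?\<nu>) 0)) (at 0)"
      unfolding H0 by (intro tendsto_norm) simp
    then have ev: "\<forall>\<^sub>F q in at 0. norm (eta_quot ?\<nu> q / q) < K"
      by (rule order_tendstoD(2)) (simp add: K_def)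
    have "((\<lambda>y. exp (- y)) \<longlongrightarrow> (0::real)) at_top"
      by (rule filterlim_compose[OF exp_at_bot filterlim_uminus_at_bot_at_top])
    then have "((\<lambda>y. complex_of_real (exp (- y))) \<longlongrightarrow> of_real 0) at_top"
      by (rule tendsto_of_real)
    then have "filterlim (\<lambda>y. complex_of_real (exp (- y))) (at 0) at_top"
      by (intro filterlim_atI) auto
    from filterlim_iff[THEN iffD1, OF this, rule_format, OF ev]
    have "\<forall>\<^sub>F y in at_top. norm (eta_quot ?\<nu> (complex_of_real (exp (- y))) / complex_of_real (exp (- y))) < K" .
    then have "\<forall>\<^sub>F y in at_top. 2 - ln K / y \<le> Im (cauchy_F \<mu> (\<i> * of_real y)) / y"
      using eventually_gt_at_top[of 0]
    proof eventually_elim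
      case (elim y)
      let ?q = "complex_of_real (exp (- y))" and ?F = "cauchy_F \<mu> (\<i> * of_real y)"
      have q: "exp (\<i> * (\<i> * complex_of_real y)) = ?q"
      proof -
        have "\<i> * (\<i> * complex_of_real y) = of_real (- y)" by (simp flip: mult.assoc)
        then show ?thesis by (simp only: exp_of_real)
      qed
      have "norm (eta_quot ?\<nu> ?q) \<le> K * exp (- y)"
        using elim(1) by (simp add: norm_divide divide_less_eq)
      then have "exp (- y) * norm (eta_quot ?\<nu> ?q) \<le> exp (- y) * (K * exp (- y))"
        by (rule mult_left_mono) simp
      also have "exp (- y) * norm (eta_quot ?\<nu> ?q) = norm (eta_T ?\<nu> ?q)"
        by (simp add: eta_T_eq_eta_quot norm_mult)
      also have "norm (eta_T ?\<nu> ?q) = exp (- Im ?F)"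
        using eta_T_wrap[OF \<mu>, of "\<i> * of_real y"] elim(2) unfolding q by simp
      also have "exp (- y) * (K * exp (- y)) = exp (ln K - 2 * y)"
      proof -
        have "exp (ln K - 2 * y) = exp (ln K) * (exp (- y) * exp (- y))" by (simp flip: exp_add)
        then show ?thesis using K by simp
      qed
      finally have "2 * y - ln K \<le> Im ?F" by simp
      then have "(2 * y - ln K) / y \<le> Im ?F / y"
        using elim(2) by (intro divide_right_mono) auto
      then show ?case using elim(2) by (simp add: diff_divide_distrib)
    qed
    moreover have "((\<lambda>y. 2 - ln K / y) \<longlongrightarrow> 2 - 0) at_top"
      by (intro tendsto_intros real_tendsto_divide_at_top[OF tendsto_const] filterlim_ident)
    ultimately have "2 - 0 \<le> (1::real)"
      by (intro tendsto_le[OF trivial_limit_at_top_linorder cauchy_F_asymptotics[OF rp]])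
    then show False by simp
  qed
  ultimately show ?thesis using \<nu> by (auto simp: class_ID_star_def)
qed

lemma exists_class_L_wrap_eq:
  assumes \<nu>: "\<nu> \<in> class_ID_star"
  shows "\<exists>\<mu> \<in> class_L. wrap \<mu> = \<nu>"
proof -
  have cp: "circle_prob \<nu>" and d0: "deriv (eta_T \<nu>) 0 \<noteq> 0"
    and zero: "\<And>q. q \<in> ball 0 1 \<Longrightarrow> eta_T \<nu> q = 0 \<Longrightarrow> q = 0"
    using \<nu> by (auto simp: class_ID_star_def)
  have nonzero: "eta_quot \<nu> q \<noteq> 0" if "q \<in> ball 0 1" for q
    using d0 zero[OF that] unfolding deriv_eta_T_0[OF cp] eta_T_eq_eta_quot by (cases "q = 0") auto
  have "(0::complex) \<in> ball 0 1" by simp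
  then obtain g where g: "g holomorphic_on ball 0 1"
    and exp_g: "\<And>q. q \<in> ball 0 1 \<Longrightarrow> exp (g q) = eta_quot \<nu> q"
    using holomorphic_logarithm_exists[OF convex_ball open_ball eta_quot_holomorphic[OF cp] nonzero] by blast
  \<comment> \<open>Another choice of the logarithm changes F by a constant in 2 \<pi> \<int>, which
    is the freedom of translating the measure.\<close>
  define F where "F z = z - \<i> * g (exp (\<i> * z))" for z
  have disc: "exp (\<i> * z) \<in> ball 0 1" if "Im z > 0" for z
    using norm_exp_i_less_one[OF that] by (simp only: mem_ball_0)
  have exp_F: "exp (\<i> * F z) = eta_T \<nu> (exp (\<i> * z))" if "Im z > 0" for z
  proof -
    have "\<i> * F z = \<i> * z + g (exp (\<i> * z))" by (simp add: F_def algebra_simps)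
    then show ?thesis using exp_g[OF disc[OF that]] by (simp add: exp_add eta_T_eq_eta_quot)
  qed
  have ImF: "Im z \<le> Im (F z)" if "Im z > 0" for z
  proof -
    have "norm (exp (\<i> * F z)) \<le> norm (exp (\<i> * z))"
      unfolding exp_F[OF that] by (rule norm_eta_T_le[OF cp norm_exp_i_less_one[OF that]])
    then show ?thesis by simp
  qed
  have "\<exists>\<mu>. real_prob \<mu> \<and> (\<forall>z. Im z > 0 \<longrightarrow> cauchy_G \<mu> z = 1 / F z)"
  proof (rule exists_real_prob_of_holomorphic[OF _ ImF])
    show "F holomorphic_on {z. Im z > 0}"
      unfolding F_def
      by (intro holomorphic_intros holomorphic_on_compose_gen[OF _ g, unfolded o_def]) (use disc in auto)
    fix \<epsilon> :: real assume "\<epsilon> > 0"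
    \<comment> \<open>The half-plane Im z \<ge> \<epsilon> is mapped into this compact disc, on
      which \<open>g\<close> is bounded.\<close>
    then have sub: "cball 0 (exp (- \<epsilon>)) \<subseteq> ball (0::complex) 1"
      by (simp add: cball_subset_ball_iff)
    have "compact (g ` cball 0 (exp (- \<epsilon>)))"
      by (intro compact_continuous_image holomorphic_on_imp_continuous_on holomorphic_on_subset[OF g sub]) auto
    then obtain C where C: "\<And>q. q \<in> cball 0 (exp (- \<epsilon>)) \<Longrightarrow> norm (g q) \<le> C"
      using compact_imp_bounded by (force simp: bounded_iff)
    have "norm (F z - z) \<le> C" if "Im z \<ge> \<epsilon>" for z
      using C[of "exp (\<i> * z)"] that by (simp add: F_def norm_mult)
    then show "\<exists>C. \<forall>z. Im z \<ge> \<epsilon> \<longrightarrow> norm (F z - z) \<le> C" by blast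
  qed
  then obtain \<mu> where \<mu>: "real_prob \<mu>" and G: "\<And>z. Im z > 0 \<Longrightarrow> cauchy_G \<mu> z = 1 / F z" by blast
  have F_eq: "cauchy_F \<mu> z = F z" if "Im z > 0" for z
    using G[OF that] by (simp add: cauchy_F_def)
  have "F (z + 2 * of_real pi) = F z + 2 * of_real pi" for z
  proof -
    have "exp (\<i> * (z + 2 * of_real pi)) = exp (\<i> * z)"
      by (simp add: distrib_left exp_add mult_ac)
    then show ?thesis by (simp add: F_def)
  qed
  then have L: "\<mu> \<in> class_L" using \<mu> by (auto simp: class_L_def F_eq)
  have "wrap \<mu> = \<nu>"
  proof (rule circle_prob_eqI_eta_T[OF circle_prob_wrap[OF \<mu>] cp])
    fix q :: complex assume "0 < norm q" "norm q < 1"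
    then obtain z where z: "Im z > 0" "exp (\<i> * z) = q" by (rule exists_exp_i_eq)
    show "eta_T (wrap \<mu>) q = eta_T \<nu> q"
      using eta_T_wrap[OF L z(1)] exp_F[OF z(1)] F_eq[OF z(1)] z(2) by simp
  qed
  with L show ?thesis by blast
qed

lemma wrap_translate:
  assumes \<mu>: "real_prob \<mu>"
  shows "wrap (translate \<mu> (2 * pi * real_of_int n)) = wrap \<mu>"
proof -
  have "cis (- (x + 2 * pi * real_of_int n)) = cis (- x)" for x
  proof -
    have "cis (- (x + 2 * pi * real_of_int n)) = cis (- x) * cis (2 * pi * of_int (- n))"
      by (simp add: cis_mult algebra_simps)
    also have "cis (2 * pi * of_int (- n)) = 1"
      by (rule cis_multiple_2pi) simp
    finally show ?thesis by simp
  qed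
  moreover have "wrap (translate \<mu> (2 * pi * real_of_int n))
      = distr \<mu> borel ((\<lambda>x. cis (- x)) \<circ> (\<lambda>x. x + 2 * pi * real_of_int n))"
    unfolding wrap_def translate_def
    by (rule distr_distr[OF borel_measurable_cis_uminus real_prob_measurable[OF \<mu>]]) measurable
  ultimately show ?thesis by (simp add: wrap_def o_def)
qed

lemma wrap_eq_imp_translate:
  assumes \<mu>: "\<mu> \<in> class_L" and \<mu>': "\<mu>' \<in> class_L" and eq: "wrap \<mu> = wrap \<mu>'"
  shows "\<exists>n::int. \<mu>' = translate \<mu> (2 * pi * real_of_int n)"
proof -
  note rp = class_L_real_prob[OF \<mu>] and rp' = class_L_real_prob[OF \<mu>']
  define D where "D z = cauchy_F \<mu>' z - cauchy_F \<mu> z" for z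
  have D: "\<exists>k::int. D z = 2 * of_real pi * of_int k" if z: "Im z > 0" for z
  proof -
    have "exp (\<i> * cauchy_F \<mu>' z) = exp (\<i> * cauchy_F \<mu> z)"
      using eta_T_wrap[OF \<mu> z] eta_T_wrap[OF \<mu>' z] eq by simp
    then obtain k :: int where "\<i> * cauchy_F \<mu>' z = \<i> * cauchy_F \<mu> z + of_int (2 * k) * pi * \<i>"
      unfolding exp_eq by blast
    then have "\<i> * D z = \<i> * (2 * of_real pi * of_int k)" by (simp add: D_def algebra_simps)
    then show ?thesis by (intro exI[of _ k]) simp
  qed
  have "D constant_on {z. Im z > 0}"
  proof (rule continuous_discrete_range_constant)
    show "connected {z. Im z > 0}" by (intro convex_connected convex_halfspace_Im_gt)
    show "continuous_on {z. Im z > 0} D"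
      unfolding D_def using isCont_cauchy_F rp rp'
      by (intro continuous_intros continuous_at_imp_continuous_on) auto
    fix z assume "z \<in> {z. Im z > 0}"
    then have z: "Im z > 0" by simp
    have "2 * pi \<le> norm (D w - D z)" if w: "Im w > 0" "D w \<noteq> D z" for w
    proof -
      obtain j k :: int where jk: "D w = 2 * of_real pi * of_int j" "D z = 2 * of_real pi * of_int k"
        using D[OF z] D[OF w(1)] by blast
      then have "j \<noteq> k" using w(2) by auto
      then have "1 \<le> \<bar>real_of_int (j - k)\<bar>" by linarith
      moreover have "D w - D z = of_real (2 * pi) * of_int (j - k)" unfolding jk by (simp add: algebra_simps)
      then have "norm (D w - D z) = 2 * pi * \<bar>real_of_int (j - k)\<bar>"
        by (simp only: norm_mult norm_of_real norm_of_int) simp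
      ultimately show ?thesis using mult_left_mono[of 1 "\<bar>real_of_int (j - k)\<bar>" "2 * pi"] by simp
    qed
    then show "\<exists>e>0. \<forall>w. w \<in> {z. Im z > 0} \<and> D w \<noteq> D z \<longrightarrow> e \<le> norm (D w - D z)"
      by (intro exI[of _ "2 * pi"]) auto
  qed
  then obtain c where c: "\<And>z. Im z > 0 \<Longrightarrow> D z = c" by (auto simp: constant_on_def)
  obtain k :: int where k: "c = 2 * of_real pi * of_int k" using D[of \<i>] c[of \<i>] by auto
  \<comment> \<open>The sign is reversed because adding 2 \<pi> k to F is the same as evaluating it
    at z + 2 \<pi> k, whereas translation by a replaces z by z - a.\<close>
  have "\<mu>' = translate \<mu> (2 * pi * real_of_int (- k))"
  proof (rule real_prob_eqI_cauchy_G[OF rp' real_prob_translate[OF rp]])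
    fix z assume z: "Im z > 0"
    have "cauchy_F \<mu>' z = cauchy_F \<mu> z + 2 * of_real pi * of_int k"
      using c[OF z] unfolding D_def k by (simp add: algebra_simps)
    also have "\<dots> = cauchy_F \<mu> (z + 2 * of_real pi * of_int k)"
      by (rule cauchy_F_add_int_multiple[OF \<mu> z, symmetric])
    finally have "cauchy_G \<mu>' z = cauchy_G \<mu> (z + 2 * of_real pi * of_int k)"
      by (simp add: cauchy_F_def)
    then show "cauchy_G \<mu>' z = cauchy_G (translate \<mu> (2 * pi * real_of_int (- k))) z"
      by (simp add: cauchy_G_translate[OF rp])
  qed
  then show ?thesis by blast
qed

theorem theorem4p3:
  shows "wrap ` class_L = class_ID_star \<and>
    (\<forall>\<mu> \<in> class_L. \<forall>z. Im z > 0 \<longrightarrow>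
           exp (\<i> * cauchy_F \<mu> z) = eta_T (wrap \<mu>) (exp (\<i> * z))) \<and>
    (\<forall>\<mu> \<in> class_L. \<forall>\<mu>' \<in> class_L.
           wrap \<mu> = wrap \<mu>' \<longleftrightarrow> (\<exists>n::int. \<mu>' = translate \<mu> (2 * pi * real_of_int n)))"
proof (intro conjI ballI allI impI)
  show "wrap ` class_L = class_ID_star"
    using wrap_in_class_ID_star exists_class_L_wrap_eq by (auto simp: image_iff)
  show "exp (\<i> * cauchy_F \<mu> z) = eta_T (wrap \<mu>) (exp (\<i> * z))" if "\<mu> \<in> class_L" "Im z > 0" for \<mu> z
    using eta_T_wrap[OF that] by simp
  show "wrap \<mu> = wrap \<mu>' \<longleftrightarrow> (\<exists>n::int. \<mu>' = translate \<mu> (2 * pi * real_of_int n))"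
    if "\<mu> \<in> class_L" "\<mu>' \<in> class_L" for \<mu> \<mu>'
    using wrap_eq_imp_translate[OF that] wrap_translate[OF class_L_real_prob[OF that(1)]] by metis
qed

end
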